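(* Let $f:\mathbb{R}^{m\times n}\to\mathbb{R}$ ($m\le n$) be continuously differentiable and satisfy the following assumptions. (a) There is a finite $f_{\mathrm{low}}$ with $f(X)\ge f_{\mathrm{low}}$ for all $X\in\mathbb{R}^{m\times n}$. (b) There are a conjugate pair $p\in[2,\infty]$, $q\in[1,2]$ and $L_{p,q}>0$ with $\|\nabla f(Y)-\nabla f(X)\|_{S_q}\le L_{p,q}\|Y-X\|_{S_p}$ for all $X,Y\in\mathbb{R}^{m\times n}$. (c) There is $V\in\mathbb{R}^{m\times m}$ such that the stochastic gradient estimator $G:\mathbb{R}^{m\times n}\times\Xi\to\mathbb{R}^{m\times n}$ satisfies, for all $X\in\mathbb{R}^{m\times n}$, $\mathbb{E}[G(X;\xi)]=\nabla f(X)$ and $\mathbb{E}[(G(X;\xi)-\nabla f(X))(G(X;\xi)-\nabla f(X))^T]\preceq VV^T$. Let $B\ge1$ be an integer, $\Delta_f:=f(X_0)-f_{\mathrm{low}}>0$ and $\sigma_{q,B}:=\|V\|_{S_q}/\sqrt{B}$. Let $K\ge1$ be any integer, and let $\{X_k\}$ be generated by the $S_p$-$S_q$ method with ball oracle (see context) with this $p$, batch size $B$ and parameters $$\eta=\sqrt{\frac{\Delta_f\theta}{L_{p,q}K}},\qquad \theta=\min\Big\{\frac{1}{\sigma_{q,B}}\sqrt{\frac{\Delta_fL_{p,q}}{K}},\,1\Big\}$$ (with $\theta=1$ if $\sigma_{q,B}=0$). Then $$\frac{1}{K}\sum_{k=0}^{K-1}\mathbb{E}[\|\nabla f(X_k)\|_{S_q}]\le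 6\sqrt{\sigma_{q,B}}\Big(\frac{\Delta_fL_{p,q}}{K}\Big)^{1/4}+8\sqrt{\frac{\Delta_fL_{p,q}}{K}}+\frac{2\sigma_{q,B}^2}{\sqrt{\Delta_fL_{p,q}K}}.$$
   Context: For $r\in[1,\infty]$, $\|Z\|_{S_r}$ is the Schatten-$r$ norm (the $\ell_r$ norm of the vector of singular values of $Z$). $p,q\in[1,\infty]$ are conjugate if $1/p+1/q=1$ with $1/\infty:=0$. $\langle\cdot,\cdot\rangle$ is the trace inner product. $A_1\preceq A_2$ means $A_2-A_1$ is positive semidefinite. $\xi$ is a random element of the measurable space $\Xi$ and $G$ is measurable. The $S_p$-$S_q$ method with ball oracle: inputs are a (deterministic) starting point $X_0\in\mathbb{R}^{m\times n}$, $\theta\in(0,1]$, $p\in[2,\infty]$, $\eta>0$, and an integer batch size $B\ge1$. For $k=0,1,2,\dots$: draw $\xi_{k,1},\dots,\xi_{k,B}$, i.i.d. copies of $\xi$ independent of all previous samples, and set $\bar G_k=\frac1B\sum_{i=1}^BG(X_k;\xi_{k,i})$; set $M_0=\bar G_0$ and $M_k=(1-\theta)M_{k-1}+\theta\bar G_k$ for $k\ge1$; let $X_{k+1}$ be a minimizer of $\langle M_k,X-X_k\rangle$ over $\{X:\|X-X_k\|_{S_p}\le\eta\}$ (when the minimizer is not unique, it is selected so that $X_{k+1}$ is measurable with respect to $\sigma(\{\xi_{s,i}:0\le s\le k,\,1\le i\le B\})$). *)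

theory Defs
  imports "HOL-Probability.Probability" "HOL-Computational_Algebra.Polynomial"
begin

definition char_poly_mat :: "real^'m^'m \<Rightarrow> real poly" where
  "char_poly_mat A = det (mat [:0, 1:] - (\<chi> i j. [:A $ i $ j:]))"

text \<open>
  The singular values of an \<open>m \<times> n\<close> matrix \<open>Z\<close>, counted with multiplicity: the square roots
  of the eigenvalues of the \<open>m \<times> m\<close> matrix \<open>Z Z\<^sup>T\<close>. For \<open>m \<le> n\<close> these are exactly the \<open>m\<close>
  singular values; for \<open>m > n\<close> the multiset contains \<open>m - n\<close> additional zeros, which do
  not affect any of the norms below.
\<close>
definition singular_values :: "real^'n^'m \<Rightarrow> real multiset" where
  "singular_values Z = image_mset sqrt (proots (char_poly_mat (Z ** transpose Z)))"

text \<open>Only meaningful for \<open>r \<in> [1, \<infinity>]\<close>.\<close>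
definition schatten_norm :: "ereal \<Rightarrow> real^'n^'m \<Rightarrow> real" where
  "schatten_norm r Z =
    (if r = \<infinity> then Max (set_mset (singular_values Z))
     else (\<Sum>s\<in>#singular_values Z. s powr real_of_ereal r) powr (1 / real_of_ereal r))"

definition psd :: "real^'m^'m \<Rightarrow> bool" where
  "psd A \<longleftrightarrow> transpose A = A \<and> (\<forall>x. 0 \<le> x \<bullet> (A *v x))"

definition loewner_le :: "real^'m^'m \<Rightarrow> real^'m^'m \<Rightarrow> bool" (infix \<open>\<preceq>\<close> 50) where
  "A \<preceq> B \<longleftrightarrow> psd (B - A)"

text \<open>
  Sampling: \<open>xs k i\<close> (\<open>1 \<le> i \<le> B\<close>) are jointly independent random elements of \<open>\<Xi>\<close> on \<open>P\<close>, each
  distributed as the random element \<open>\<xi>\<close>, which may live on another probability space \<open>Q\<close>.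
\<close>
definition iid_batches ::
  "'w measure \<Rightarrow> 'x measure \<Rightarrow> 'z measure \<Rightarrow> ('z \<Rightarrow> 'x) \<Rightarrow> nat \<Rightarrow> (nat \<Rightarrow> nat \<Rightarrow> 'w \<Rightarrow> 'x) \<Rightarrow> bool" where
  "iid_batches P \<Xi> Q \<xi> B xs \<longleftrightarrow>
     prob_space.indep_vars P (\<lambda>_. \<Xi>) (\<lambda>(k, i). xs k i) (UNIV \<times> {1..B}) \<and>
     (\<forall>k. \<forall>i\<in>{1..B}. distr P \<Xi> (xs k i) = distr Q \<Xi> \<xi>)"

definition batch_mean :: "('a \<Rightarrow> 'x \<Rightarrow> 'a) \<Rightarrow> nat \<Rightarrow> 'a \<Rightarrow> (nat \<Rightarrow> 'x) \<Rightarrow> 'a::real_vector" where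
  "batch_mean G B Y x = (1 / real B) *\<^sub>R (\<Sum>i=1..B. G Y (x i))"

primrec momentum :: "real \<Rightarrow> (nat \<Rightarrow> 'a) \<Rightarrow> nat \<Rightarrow> 'a::real_vector" where
  "momentum \<theta> g 0 = g 0"
| "momentum \<theta> g (Suc k) = (1 - \<theta>) *\<^sub>R momentum \<theta> g k + \<theta> *\<^sub>R g (Suc k)"

text \<open>
  \<open>X\<close> is a sequence of iterates produced by the \<open>S\<^sub>p\<close>-\<open>S\<^sub>q\<close> method with ball oracle from the samples
  \<open>xs\<close>. On \<open>real^'n^'m\<close> the inner product \<open>\<bullet>\<close> is the trace inner product.
\<close>
definition ball_oracle_iterates ::
  "'w measure \<Rightarrow> 'x measure \<Rightarrow> (nat \<Rightarrow> nat \<Rightarrow> 'w \<Rightarrow> 'x) \<Rightarrow> (real^'n^'m \<Rightarrow> 'x \<Rightarrow> real^'n^'m) \<Rightarrow>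
   real^'n^'m \<Rightarrow> real \<Rightarrow> ereal \<Rightarrow> real \<Rightarrow> nat \<Rightarrow> (nat \<Rightarrow> 'w \<Rightarrow> real^'n^'m) \<Rightarrow> bool" where
  "ball_oracle_iterates P \<Xi> xs G X0 \<theta> p \<eta> B X \<longleftrightarrow>
     (\<forall>\<omega>\<in>space P. X 0 \<omega> = X0) \<and>
     (\<forall>k. \<forall>\<omega>\<in>space P.
        let M = momentum \<theta> (\<lambda>j. batch_mean G B (X j \<omega>) (\<lambda>i. xs j i \<omega>)) k
        in is_arg_min (\<lambda>Y. M \<bullet> (Y - X k \<omega>)) (\<lambda>Y. schatten_norm p (Y - X k \<omega>) \<le> \<eta>)
             (X (Suc k) \<omega>)) \<and>
     (\<forall>k. X (Suc k) \<in> borel_measurable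
        (sigma (space P)
          {xs s i -` A \<inter> space P | s i A. s \<le> k \<and> i \<in> {1..B} \<and> A \<in> sets \<Xi>}))"

end

theory Submission
  imports Defs
begin

text \<open>
  Let \<open>M\<^sub>k\<close> be the momentum and \<open>E\<^sub>k = M\<^sub>k - \<nabla>f(X\<^sub>k)\<close>. By duality of \<open>S\<^sub>p\<close> and \<open>S\<^sub>q\<close> the oracle step decreases
  \<open>\<langle>M\<^sub>k, \<cdot>\<rangle>\<close> by \<open>\<eta> \<parallel>M\<^sub>k\<parallel>\<^sub>q\<close>, and smoothness gives
  \<open>\<eta> \<parallel>\<nabla>f(X\<^sub>k)\<parallel>\<^sub>q \<le> f(X\<^sub>k) - f(X\<^sub>k\<^sub>+\<^sub>1) + 2 \<eta> \<parallel>E\<^sub>k\<parallel>\<^sub>q + L \<eta>\<^sup>2 / 2\<close>, which is summed over \<open>k\<close>.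
  By linearity of the momentum recursion, \<open>E\<^sub>k\<close> splits into a drift of norm at most \<open>L \<eta> (1 - \<theta>) / \<theta>\<close> and a
  noise \<open>N\<^sub>k\<close>, a linear combination of the individual oracle errors. These errors are pairwise uncorrelated, so
  the second moment matrix of \<open>N\<^sub>k\<close> is at most \<open>c V V\<^sup>T\<close> with \<open>c = ((1 - \<theta>)\<^sup>2\<^sup>k + \<theta>) / B\<close>. Since
  \<open>q \<le> 2\<close>, the map \<open>A \<mapsto> tr A\<^sup>q\<^sup>/\<^sup>2\<close> is concave and monotone, and Jensen's inequality turns this into
  \<open>E \<parallel>N\<^sub>k\<parallel>\<^sub>q \<le> c\<^sup>1\<^sup>/\<^sup>2 \<parallel>V\<parallel>\<^sub>q\<close>. For the given \<open>\<eta>\<close> and \<open>\<theta>\<close> the sum of the terms is the claimed bound.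
\<close>

section \<open>Orthonormal eigenbases and singular values\<close>

text \<open>A maximizer \<open>x\<close> of the Rayleigh quotient on the unit sphere of
  \<open>S\<close> works: by first-order optimality \<open>T x\<close> is orthogonal to every vector
  of \<open>S\<close> orthogonal to \<open>x\<close>, in particular to
  \<open>T x - c *\<^sub>R x\<close> itself. The invariant subspace \<open>S\<close> is there for
  the induction that follows.\<close>

lemma self_adjoint_eigenvector:
  fixes T :: "'a::euclidean_space \<Rightarrow> 'a"
  assumes T: "linear T" and sym: "\<And>x y. x \<bullet> T y = T x \<bullet> y"
    and S: "subspace S" "\<And>x. x \<in> S \<Longrightarrow> T x \<in> S" and y: "y \<in> S" "y \<noteq> 0"
  shows "\<exists>x c. x \<in> S \<and> norm x = 1 \<and> T x = c *\<^sub>R x"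
proof -
  let ?C = "S \<inter> sphere 0 1"
  have "compact ?C"
    by (intro closed_Int_compact closed_subspace S) auto
  moreover have "(1 / norm y) *\<^sub>R y \<in> ?C"
    using y S by (auto simp: subspace_scale)
  moreover have "continuous_on ?C (\<lambda>x. x \<bullet> T x)"
    by (intro continuous_intros linear_continuous_on linear_linear[THEN iffD2] T)
  ultimately obtain x where x: "x \<in> ?C" and max: "\<And>z. z \<in> ?C \<Longrightarrow> z \<bullet> T z \<le> x \<bullet> T x"
    using continuous_attains_sup[of ?C "\<lambda>x. x \<bullet> T x"] by blast
  define c where "c = x \<bullet> T x"
  have nx: "x \<bullet> x = 1" "x \<in> S"
    using x by (auto simp: norm_eq_1)
  have le: "z \<bullet> T z \<le> c * (z \<bullet> z)" if "z \<in> S" for z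
  proof (cases "z = 0")
    case False
    then have "(1 / norm z) *\<^sub>R z \<in> ?C"
      using that S by (auto simp: subspace_scale)
    from max[OF this] have "(z \<bullet> T z) / (norm z)\<^sup>2 \<le> c"
      by (simp add: linear_scale[OF T] c_def power2_eq_square)
    then show ?thesis
      using False by (simp add: field_simps power2_norm_eq_inner)
  qed (simp add: linear_0[OF T])
  have orth: "z \<bullet> T x = 0" if z: "z \<in> S" "z \<bullet> x = 0" for z
  proof (rule ccontr)
    assume ne: "z \<bullet> T x \<noteq> 0"
    define b where "b = z \<bullet> T x"
    define a where "a = c * (z \<bullet> z) - z \<bullet> T z"
    \<comment> \<open>Perturbing the maximizer to \<open>x + t *\<^sub>R z\<close> leaves a linear
      term in \<open>t\<close> that the quadratic term would have to dominate for all
      \<open>t\<close>.\<close>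
    have key: "2 * t * b \<le> t\<^sup>2 * a" for t
    proof -
      have "x + t *\<^sub>R z \<in> S"
        using nx z S by (auto simp: subspace_add subspace_scale)
      from le[OF this] show ?thesis
        using nx z sym[of x z]
        by (simp add: linear_add[OF T] linear_scale[OF T] inner_add_left inner_add_right
            c_def[symmetric] b_def a_def inner_commute power2_eq_square algebra_simps)
    qed
    have "a \<ge> 0"
      using le[OF z(1)] by (simp add: a_def)
    \<comment> \<open>Any small multiple of \<open>b\<close> gives the contradiction; the
      denominator \<open>a + 1\<close> is positive even when \<open>a = 0\<close>.\<close>
    define t where "t = b / (a + 1)"
    have bt: "b = t * (a + 1)" and "t \<noteq> 0"
      using \<open>a \<ge> 0\<close> ne by (auto simp: t_def b_def)
    have "t\<^sup>2 * (a + 2) \<le> 0"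
      using key[of t] by (simp add: bt power2_eq_square algebra_simps)
    moreover have "t\<^sup>2 * (a + 2) > 0"
      using \<open>t \<noteq> 0\<close> \<open>a \<ge> 0\<close> by (intro mult_pos_pos) auto
    ultimately show False
      by simp
  qed
  define z where "z = T x - c *\<^sub>R x"
  have "z \<in> S"
    using nx S by (auto simp: z_def subspace_diff subspace_scale)
  moreover have zx: "z \<bullet> x = 0"
    by (simp add: z_def inner_diff_left inner_diff_right nx c_def inner_commute)
  ultimately have "z \<bullet> T x = 0"
    using orth by blast
  moreover have "z \<bullet> z = z \<bullet> T x - c * (z \<bullet> x)"
    by (subst (2) z_def) (simp add: inner_diff_right)
  ultimately have "z \<bullet> z = 0"
    using zx by simp
  then have "T x = c *\<^sub>R x"
    by (simp add: z_def)
  then show ?thesis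
    using x by (intro exI[of _ x] exI[of _ c]) auto
qed

text \<open>Induction on the number of vectors: the orthogonal complement of eigenvectors is
  invariant under a self-adjoint map and is nontrivial as long as the dimension is not exhausted, so
  it contains a further eigenvector.\<close>

lemma self_adjoint_orthonormal_eigenvectors:
  fixes T :: "'a::euclidean_space \<Rightarrow> 'a"
  assumes T: "linear T" and sym: "\<And>x y. x \<bullet> T y = T x \<bullet> y" and "n \<le> DIM('a)"
  shows "\<exists>B. finite B \<and> card B = n \<and> pairwise orthogonal B \<and> (\<forall>b\<in>B. norm b = 1 \<and> (\<exists>c. T b = c *\<^sub>R b))"
  using \<open>n \<le> DIM('a)\<close>
proof (induction n)
  case 0
  then show ?case by (intro exI[of _ "{}"]) auto
next
  case (Suc n)
  then obtain B where B: "finite B" "card B = n" "pairwise orthogonal B"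
    "\<And>b. b \<in> B \<Longrightarrow> norm b = 1" "\<And>b. b \<in> B \<Longrightarrow> \<exists>c. T b = c *\<^sub>R b"
    by auto
  define S where "S = {y. \<forall>b\<in>B. b \<bullet> y = 0}"
  have "subspace S"
    by (auto simp: S_def subspace_def inner_add_right)
  moreover have "T y \<in> S" if "y \<in> S" for y
  proof -
    have "b \<bullet> T y = 0" if "b \<in> B" for b
      using B(5)[OF that] \<open>y \<in> S\<close> that by (auto simp: sym S_def)
    then show ?thesis by (simp add: S_def)
  qed
  moreover have "dim (span B) < DIM('a)"
    using Suc.prems B(1,2) dim_le_card'[of B] by auto
  then obtain y where y: "y \<noteq> 0" "\<And>b. b \<in> span B \<Longrightarrow> orthogonal y b"
    using orthogonal_to_subspace_exists[of B] by auto
  then have "y \<in> S"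
    by (auto simp: S_def orthogonal_def span_base inner_commute)
  ultimately obtain x c where x: "x \<in> S" "norm x = 1" "T x = c *\<^sub>R x"
    using self_adjoint_eigenvector[OF T sym, of S y] y(1) by blast
  have "x \<notin> B"
    using x by (force simp: S_def norm_eq_1)
  then show ?case
    using B x by (intro exI[of _ "insert x B"])
      (auto simp: pairwise_insert pairwise_def S_def orthogonal_def inner_commute)
qed

text \<open>Indexing the family by \<open>'m\<close> gives as many vectors as the dimension of
  \<open>real^'m\<close>, so an orthonormal family is automatically a basis.\<close>

definition orthonormal :: "('m::finite \<Rightarrow> real^'m) \<Rightarrow> bool" where
  "orthonormal u \<longleftrightarrow> (\<forall>i j. u i \<bullet> u j = of_bool (i = j))"

lemma symmetric_matrix_orthonormal_eigenbasis:
  fixes A :: "real^'m^'m"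
  assumes "transpose A = A"
  obtains u c where "orthonormal u" "\<And>i. A *v u i = c i *\<^sub>R u i"
proof -
  have "x \<bullet> (A *v y) = (A *v x) \<bullet> y" for x y
    using assms by (metis dot_lmul_matrix transpose_matrix_vector)
  with self_adjoint_orthonormal_eigenvectors[of "\<lambda>x. A *v x" "CARD('m)"]
  obtain B where B: "finite B" "card B = CARD('m)" "pairwise orthogonal B"
    "\<And>b. b \<in> B \<Longrightarrow> norm b = 1" "\<And>b. b \<in> B \<Longrightarrow> \<exists>c. A *v b = c *\<^sub>R b"
    by auto
  obtain u where u: "bij_betw u (UNIV :: 'm set) B"
    using B by (metis finite_same_card_bij finite)
  have uB: "u i \<in> B" for i
    using u by (auto simp: bij_betw_def)
  have "u i \<bullet> u j = of_bool (i = j)" for i j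
  proof (cases "i = j")
    case False
    then have "u i \<noteq> u j"
      using u by (auto simp: bij_betw_def inj_on_def)
    then show ?thesis
      using False B(3) uB by (auto simp: pairwise_def orthogonal_def)
  qed (use B(4) uB in \<open>auto simp: norm_eq_1[symmetric]\<close>)
  moreover have "\<exists>c. \<forall>i. A *v u i = c i *\<^sub>R u i"
    using B(5) uB by (intro choice) auto
  ultimately show ?thesis
    using that[of u] by (auto simp: orthonormal_def)
qed

text \<open>A right inverse of a square matrix is also a left inverse, so orthonormal rows give
  orthonormal columns. Expansion and Parseval both rest on this relation.\<close>

lemma orthonormal_transpose:
  assumes "orthonormal u"
  shows "(\<Sum>i\<in>UNIV. u i $ k * u i $ l) = of_bool (k = l)"
proof -
  let ?U = "\<chi> i j. u i $ j"
  have "?U ** transpose ?U = mat 1"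
    using assms by (simp add: orthonormal_def vec_eq_iff matrix_matrix_mult_def transpose_def mat_def inner_vec_def)
  then have "transpose ?U ** ?U = mat 1"
    by (simp add: matrix_left_right_inverse)
  then show ?thesis
    by (simp add: vec_eq_iff matrix_matrix_mult_def transpose_def mat_def)
qed

lemma orthonormal_expansion:
  assumes "orthonormal u"
  shows "(\<Sum>i\<in>UNIV. (u i \<bullet> x) *\<^sub>R u i) = x"
proof -
  have "(\<Sum>i\<in>UNIV. (u i \<bullet> x) * u i $ k) = x $ k" for k
  proof -
    have "(\<Sum>i\<in>UNIV. (u i \<bullet> x) * u i $ k) = (\<Sum>i\<in>UNIV. \<Sum>l\<in>UNIV. x $ l * (u i $ l * u i $ k))"
      by (simp add: inner_vec_def sum_distrib_left sum_distrib_right ac_simps)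
    also have "\<dots> = (\<Sum>l\<in>UNIV. x $ l * (\<Sum>i\<in>UNIV. u i $ l * u i $ k))"
      by (subst sum.swap) (simp add: sum_distrib_left)
    finally show ?thesis
      by (simp add: orthonormal_transpose[OF assms])
  qed
  then show ?thesis
    by (simp add: vec_eq_iff)
qed

lemma orthonormal_parseval:
  assumes "orthonormal u"
  shows "(\<Sum>i\<in>UNIV. (u i \<bullet> x) * (u i \<bullet> y)) = x \<bullet> y"
proof -
  have "x \<bullet> y = (\<Sum>i\<in>UNIV. (u i \<bullet> x) *\<^sub>R u i) \<bullet> y"
    by (simp add: orthonormal_expansion[OF assms])
  then show ?thesis
    by (simp add: inner_sum_left)
qed

text \<open>Parseval in each column: the trace inner product may be computed row by row in any
  orthonormal basis.\<close>

lemma orthonormal_inner_matrix: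
  fixes A B :: "real^'n^'m"
  assumes "orthonormal u"
  shows "(\<Sum>i\<in>UNIV. (u i v* A) \<bullet> (u i v* B)) = A \<bullet> B"
proof -
  have "(\<Sum>i\<in>UNIV. (u i v* A) \<bullet> (u i v* B)) =
      (\<Sum>i\<in>UNIV. \<Sum>k\<in>UNIV. (u i \<bullet> column k A) * (u i \<bullet> column k B))"
    by (simp add: inner_vec_def vector_matrix_mult_def column_def)
  also have "\<dots> = (\<Sum>k\<in>UNIV. column k A \<bullet> column k B)"
    by (subst sum.swap) (simp add: orthonormal_parseval[OF assms])
  also have "\<dots> = A \<bullet> B"
    unfolding inner_vec_def column_def by (subst sum.swap) simp
  finally show ?thesis .
qed

text \<open>Conjugation by the orthogonal matrix with rows \<open>u i\<close> diagonalizes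
  \<open>A\<close> and leaves the characteristic polynomial unchanged, because the two outer
  determinants multiply to 1.\<close>

lemma char_poly_mat_orthonormal_eigenbasis:
  fixes A :: "real^'m^'m"
  assumes u: "orthonormal u" and A: "\<And>i j. u i \<bullet> (A *v u j) = (if i = j then c i else 0)"
  shows "char_poly_mat A = (\<Prod>i\<in>UNIV. [:- c i, 1:])"
proof -
  \<comment> \<open>\<open>C\<close> embeds real matrices multiplicatively as matrices of constant
    polynomials, so that conjugation can be done inside the determinant.\<close>
  define C :: "real^'m^'m \<Rightarrow> real poly^'m^'m" where "C M = (\<chi> i j. [:M $ i $ j:])" for M :: "real^'m^'m"
  have sum_const: "(\<Sum>k\<in>S. [:g k:]) = [:\<Sum>k\<in>S. g k:]" for g :: "'m \<Rightarrow> real" and S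
    by (induction S rule: infinite_finite_induct) auto
  have C_mult: "C (M ** N) = C M ** C N" for M N
    by (simp add: C_def vec_eq_iff matrix_matrix_mult_def sum_const mult.commute)
  define U :: "real^'m^'m" where "U = (\<chi> i. u i)"
  let ?X = "mat [:0, 1:] :: real poly^'m^'m"
  have UU: "U ** transpose U = mat 1"
    using u by (simp add: orthonormal_def vec_eq_iff matrix_matrix_mult_def transpose_def mat_def inner_vec_def U_def)
  have C1: "C (mat 1) = mat 1"
    by (simp add: C_def vec_eq_iff mat_def one_pCons)
  have CU: "C U ** C (transpose U) = mat 1"
    using UU by (simp add: C_mult[symmetric] C1)
  have X_comm: "N ** ?X = ?X ** N" for N
    by (simp add: vec_eq_iff matrix_matrix_mult_def mat_def if_distrib if_distribR mult.commute cong: if_cong)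
  have sub: "M ** (N - N') = M ** N - M ** N'" "(N - N') ** M = N ** M - N' ** M"
    for M N N' :: "real poly^'m^'m"
    by (simp_all add: vec_eq_iff matrix_matrix_mult_def algebra_simps sum_subtractf)
  have "det (C U) * det (C (transpose U)) = 1"
    using CU by (metis det_I det_mul)
  then have "char_poly_mat A = det (C U) * det (?X - C A) * det (C (transpose U))"
    by (simp add: char_poly_mat_def C_def[symmetric] mult.commute mult.left_commute)
  also have "\<dots> = det (C U ** (?X - C A) ** C (transpose U))"
    by (simp add: det_mul)
  also have "C U ** (?X - C A) ** C (transpose U) = ?X - C (U ** A ** transpose U)"
    by (simp add: sub X_comm matrix_mul_assoc[symmetric] CU C_mult)
  also have "U ** A ** transpose U = (\<chi> i j. if i = j then c i else 0)"
  proof -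
    have "(U ** A ** transpose U) $ i $ j = (u i v* A) \<bullet> u j" for i j
      by (simp add: matrix_matrix_mult_def transpose_def vector_matrix_mult_def inner_vec_def U_def mult.commute)
    then show ?thesis
      by (simp add: vec_eq_iff A dot_lmul_matrix)
  qed
  also have "det (?X - C (\<chi> i j. if i = j then c i else 0)) = (\<Prod>i\<in>UNIV. [:- c i, 1:])"
    by (subst det_diagonal) (auto simp: C_def mat_def)
  finally show ?thesis .
qed

text \<open>The vector \<open>u i v* Z\<close> is \<open>transpose Z\<close> applied to
  \<open>u i\<close>, so the condition says that \<open>Z ** transpose Z\<close> is diagonal in the
  basis \<open>u\<close>. This is the left half of a singular value decomposition; the right
  singular vectors stay implicit in the rows \<open>u i v* Z\<close>.\<close>

definition left_singular_basis :: "('m::finite \<Rightarrow> real^'m) \<Rightarrow> real^'n^'m \<Rightarrow> bool" where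
  "left_singular_basis u Z \<longleftrightarrow> orthonormal u \<and> (\<forall>i j. i \<noteq> j \<longrightarrow> (u i v* Z) \<bullet> (u j v* Z) = 0)"

lemma left_singular_basis_exists:
  obtains u where "left_singular_basis u Z"
proof -
  have "transpose (Z ** transpose Z) = Z ** transpose Z"
    by (simp add: matrix_transpose_mul transpose_transpose)
  then obtain u c where u: "orthonormal u" "\<And>i. (Z ** transpose Z) *v u i = c i *\<^sub>R u i"
    using symmetric_matrix_orthonormal_eigenbasis by blast
  have "(u i v* Z) \<bullet> (u j v* Z) = c j * (u i \<bullet> u j)" for i j
    using u(2)[of j] by (simp add: dot_lmul_matrix matrix_vector_mul_assoc[symmetric])
  then show ?thesis
    using that[of u] u(1) by (simp add: left_singular_basis_def orthonormal_def)
qed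

text \<open>In the basis \<open>u\<close> the matrix \<open>Z ** transpose Z\<close> is diagonal
  with entries the squared norms of \<open>u i v* Z\<close>, so the roots of its characteristic
  polynomial are explicit. From here on Schatten norms are computed from these norms only.\<close>

lemma singular_values_left_singular_basis:
  assumes "left_singular_basis u Z"
  shows "singular_values Z = image_mset (\<lambda>i. norm (u i v* Z)) (mset_set UNIV)"
proof -
  have "char_poly_mat (Z ** transpose Z) = (\<Prod>i\<in>UNIV. [:- ((norm (u i v* Z))\<^sup>2), 1:])"
    using assms
    by (intro char_poly_mat_orthonormal_eigenbasis)
      (auto simp: left_singular_basis_def matrix_vector_mul_assoc[symmetric] dot_lmul_matrix[symmetric]
        power2_norm_eq_inner)
  moreover have "(\<Sum>i\<in>S. {#(norm (u i v* Z))\<^sup>2#}) = image_mset (\<lambda>i. (norm (u i v* Z))\<^sup>2) (mset_set S)" for S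
    by (induction S rule: infinite_finite_induct) auto
  ultimately show ?thesis
    by (simp add: singular_values_def proots_prod multiset.map_comp o_def)
qed

lemma schatten_norm_left_singular_basis:
  assumes "left_singular_basis u Z"
  shows "schatten_norm r Z =
    (if r = \<infinity> then MAX i. norm (u i v* Z)
     else (\<Sum>i\<in>UNIV. norm (u i v* Z) powr real_of_ereal r) powr (1 / real_of_ereal r))"
  by (simp add: schatten_norm_def singular_values_left_singular_basis[OF assms] sum_unfold_sum_mset
      multiset.map_comp o_def)

section \<open>Schatten norms and their duality\<close>

text \<open>The concave function \<open>x powr a\<close> lies below its tangent at \<open>h\<close>;
  this is Young's inequality for \<open>x\<close> and \<open>h\<close> with weights \<open>a\<close>
  and \<open>1 - a\<close>, divided by \<open>h powr (1 - a)\<close>. Averaging or integrating this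
  linear bound yields every Jensen inequality below.\<close>

lemma powr_tangent:
  fixes x h a :: real
  assumes "0 \<le> x" "0 < h" "0 < a" "a \<le> 1"
  shows "x powr a \<le> a * (h powr (a - 1) * x) + (1 - a) * h powr a"
proof (cases "x = 0")
  case False
  then have "x powr a * h powr (1 - a) \<le> a * x + (1 - a) * h"
    using assms by (intro Youngs_inequality_0) auto
  then have "x powr a * h powr (1 - a) * h powr (a - 1) \<le> (a * x + (1 - a) * h) * h powr (a - 1)"
    by (rule mult_right_mono) simp
  moreover have "h powr (1 - a) * h powr (a - 1) = 1"
    using assms by (simp add: powr_add[symmetric])
  then have "x powr a * h powr (1 - a) * h powr (a - 1) = x powr a"
    by (simp only: mult.assoc mult_1_right)
  moreover have "(a * x + (1 - a) * h) * h powr (a - 1) = a * (h powr (a - 1) * x) + (1 - a) * (h * h powr (a - 1))"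
    by (simp add: algebra_simps)
  moreover have "h * h powr (a - 1) = h powr a"
    using assms by (simp add: powr_mult_base)
  ultimately show ?thesis
    by simp
qed (use assms in auto)

text \<open>Jensen for the convex power \<open>k\<close>: the tangent of the inverse power
  \<open>1/k\<close> at \<open>s powr k\<close>, evaluated at \<open>x i powr k\<close>, is averaged
  with the weights \<open>c i\<close>.\<close>

lemma powr_weighted_mean_le:
  fixes c x :: "'i \<Rightarrow> real"
  assumes "finite I" "\<And>i. i \<in> I \<Longrightarrow> 0 \<le> c i" "(\<Sum>i\<in>I. c i) = 1" "\<And>i. i \<in> I \<Longrightarrow> 0 \<le> x i" "1 \<le> k"
  shows "(\<Sum>i\<in>I. c i * x i) powr k \<le> (\<Sum>i\<in>I. c i * x i powr k)"
proof -
  define s where "s = (\<Sum>i\<in>I. c i * x i)"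
  define S where "S = (\<Sum>i\<in>I. c i * x i powr k)"
  have "0 \<le> s"
    using assms by (auto simp: s_def intro!: sum_nonneg)
  show ?thesis
  proof (cases "s = 0")
    case True
    then show ?thesis
      using assms by (auto simp: s_def[symmetric] intro!: sum_nonneg)
  next
    case False
    then have "0 < s"
      using \<open>0 \<le> s\<close> by simp
    have tangent: "x i \<le> 1/k * (s powr (1 - k) * x i powr k) + (1 - 1/k) * s" if "i \<in> I" for i
      using powr_tangent[of "x i powr k" "s powr k" "1/k"] assms that \<open>0 < s\<close>
      by (simp add: powr_powr right_diff_distrib)
    have "s \<le> (\<Sum>i\<in>I. c i * (1/k * (s powr (1 - k) * x i powr k) + (1 - 1/k) * s))"
      unfolding s_def[symmetric] using assms tangent
      by (subst s_def) (intro sum_mono mult_left_mono, auto)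
    also have "\<dots> = 1/k * s powr (1 - k) * S + (1 - 1/k) * s * (\<Sum>i\<in>I. c i)"
      by (simp add: distrib_left sum.distrib S_def sum_distrib_left sum_distrib_right ac_simps)
    finally have "s \<le> s powr (1 - k) * S"
      using assms by (simp add: field_simps)
    then have "s * s powr (k - 1) \<le> s powr (1 - k) * S * s powr (k - 1)"
      by (rule mult_right_mono) simp
    moreover have "s powr (1 - k) * S * s powr (k - 1) = S"
      using \<open>0 < s\<close> by (simp add: mult.commute mult.left_commute powr_add[symmetric])
    ultimately show ?thesis
      using \<open>0 < s\<close> by (simp add: powr_mult_base s_def[symmetric] S_def[symmetric])
  qed
qed

text \<open>Both families are normalized to unit norm and Young's inequality is applied termwise; if
  one power sum vanishes, so does the left side.\<close>

lemma holder_sum_powr: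
  fixes a b :: "'i \<Rightarrow> real"
  assumes "finite I" "\<And>i. i \<in> I \<Longrightarrow> 0 \<le> a i" "\<And>i. i \<in> I \<Longrightarrow> 0 \<le> b i"
    and rs: "1 < r" "1 < s" "1 / r + 1 / s = 1"
  shows "(\<Sum>i\<in>I. a i * b i) \<le> (\<Sum>i\<in>I. a i powr r) powr (1 / r) * (\<Sum>i\<in>I. b i powr s) powr (1 / s)"
proof (cases "(\<Sum>i\<in>I. a i powr r) = 0 \<or> (\<Sum>i\<in>I. b i powr s) = 0")
  case True
  then have "(\<forall>i\<in>I. a i = 0) \<or> (\<forall>i\<in>I. b i = 0)"
    using assms by (simp add: sum_nonneg_eq_0_iff)
  then show ?thesis
    by auto
next
  case False
  define \<alpha> where "\<alpha> = (\<Sum>i\<in>I. a i powr r) powr (1 / r)"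
  define \<beta> where "\<beta> = (\<Sum>i\<in>I. b i powr s) powr (1 / s)"
  have pos: "(\<Sum>i\<in>I. a i powr r) > 0" "(\<Sum>i\<in>I. b i powr s) > 0"
    using False by (auto simp: order_less_le intro!: sum_nonneg)
  then have *: "\<alpha> > 0" "\<beta> > 0" "\<alpha> powr r = (\<Sum>i\<in>I. a i powr r)" "\<beta> powr s = (\<Sum>i\<in>I. b i powr s)"
    using rs False by (auto simp: \<alpha>_def \<beta>_def powr_powr)
  have "(\<Sum>i\<in>I. (a i / \<alpha>) * (b i / \<beta>)) \<le> (\<Sum>i\<in>I. (a i / \<alpha>) powr r / r + (b i / \<beta>) powr s / s)"
    using assms * by (intro sum_mono Youngs_inequality) auto
  also have "\<dots> = (\<Sum>i\<in>I. a i powr r) / \<alpha> powr r / r + (\<Sum>i\<in>I. b i powr s) / \<beta> powr s / s"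
    using assms * by (simp add: sum.distrib powr_divide flip: sum_divide_distrib)
  also have "\<dots> = 1"
    using * rs pos by simp
  finally have "(\<Sum>i\<in>I. a i * b i) / (\<alpha> * \<beta>) \<le> 1"
    by (simp add: sum_divide_distrib)
  then show ?thesis
    using * by (simp add: \<alpha>_def[symmetric] \<beta>_def[symmetric])
qed

section \<open>Comparison of a singular basis with another orthonormal basis\<close>

lemma vector_matrix_mult_sum_left: "(\<Sum>i\<in>I. x i) v* (A :: real^'n^'m) = (\<Sum>i\<in>I. x i v* A)"
  by (induction I rule: infinite_finite_induct) (auto simp: vector_matrix_left_distrib)

text \<open>Expanding \<open>x\<close> in the basis \<open>w\<close>, the images
  \<open>w j v* B\<close> are pairwise orthogonal, so Pythagoras applies.\<close>

lemma norm_vector_matrix_left_singular_basis: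
  assumes "left_singular_basis w B"
  shows "(norm (x v* B))\<^sup>2 = (\<Sum>j\<in>UNIV. (w j \<bullet> x)\<^sup>2 * (norm (w j v* B))\<^sup>2)"
proof -
  have w: "orthonormal w" "\<And>i j. i \<noteq> j \<Longrightarrow> (w i v* B) \<bullet> (w j v* B) = 0"
    using assms by (auto simp: left_singular_basis_def)
  have "x v* B = (\<Sum>j\<in>UNIV. (w j \<bullet> x) *\<^sub>R (w j v* B))"
    by (subst orthonormal_expansion[OF w(1), of x, symmetric])
      (simp add: vector_matrix_mult_sum_left scaleR_vector_matrix_assoc)
  moreover have "(norm (\<Sum>j\<in>UNIV. (w j \<bullet> x) *\<^sub>R (w j v* B)))\<^sup>2
      = (\<Sum>j\<in>UNIV. (norm ((w j \<bullet> x) *\<^sub>R (w j v* B)))\<^sup>2)"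
    using w by (intro norm_sum_Pythagorean) (auto simp: pairwise_def orthogonal_def)
  ultimately show ?thesis
    by (simp add: power_mult_distrib)
qed

text \<open>Used with both orders of the bases, this makes the squared overlaps a doubly stochastic
  matrix, which is what lets Jensen compare quantities in two bases.\<close>

lemma orthonormal_sum_squares:
  assumes "orthonormal u" "orthonormal w"
  shows "(\<Sum>j\<in>UNIV. (w j \<bullet> u i)\<^sup>2) = 1"
  using orthonormal_parseval[OF assms(2), of "u i" "u i"] assms(1)
  by (simp add: orthonormal_def power2_eq_square)

lemma power2_powr_half: "0 \<le> x \<Longrightarrow> (x\<^sup>2) powr (r / 2) = x powr r" for x :: real
  using powr_powr[of x 2 "r / 2"] by simp

text \<open>This is the concavity of \<open>A \<mapsto> tr A\<^sup>r\<^sup>/\<^sup>2\<close>, linearized at the matrix with eigenvalues \<open>h j\<close>.\<close>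

lemma sum_powr_singular_values_le:
  assumes u: "left_singular_basis u N" and w: "orthonormal w" and h: "\<And>j. h j > 0" and r: "0 < r" "r \<le> 2"
  shows "(\<Sum>i\<in>UNIV. norm (u i v* N) powr r) \<le>
    (r/2) * (\<Sum>j\<in>UNIV. h j powr (r/2 - 1) * (norm (w j v* N))\<^sup>2) + (1 - r/2) * (\<Sum>j\<in>UNIV. h j powr (r/2))"
proof -
  define l where "l i = (norm (u i v* N))\<^sup>2" for i
  define c where "c i j = (u i \<bullet> w j)\<^sup>2" for i j
  have u': "orthonormal u"
    using u by (simp add: left_singular_basis_def)
  have cj: "(\<Sum>j\<in>UNIV. c i j) = 1" and ci: "(\<Sum>i\<in>UNIV. c i j) = 1" for i j
    using orthonormal_sum_squares[OF u' w, of i] orthonormal_sum_squares[OF w u', of j]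
    by (simp_all add: c_def inner_commute)
  have l: "l i powr (r/2) = norm (u i v* N) powr r" for i
    by (simp add: l_def power2_powr_half)
  \<comment> \<open>The overlaps \<open>c i j\<close> are inserted using row sums 1, so that each
    pair can use the tangent at \<open>h j\<close>. After exchanging the sums, column sums 1
    collapse the constant terms, and the mean of the \<open>l i\<close> becomes the squared norm of
    \<open>w j v* N\<close>.\<close>
  have "(\<Sum>i\<in>UNIV. l i powr (r/2)) = (\<Sum>i\<in>UNIV. \<Sum>j\<in>UNIV. c i j * l i powr (r/2))"
    by (simp add: sum_distrib_right[symmetric] cj)
  also have "\<dots> \<le> (\<Sum>i\<in>UNIV. \<Sum>j\<in>UNIV. c i j * (r/2 * (h j powr (r/2 - 1) * l i) + (1 - r/2) * h j powr (r/2)))"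
    using r h by (intro sum_mono mult_left_mono powr_tangent) (auto simp: c_def l_def)
  also have "\<dots> = (\<Sum>j\<in>UNIV. \<Sum>i\<in>UNIV. r/2 * (h j powr (r/2 - 1) * (c i j * l i)) + (1 - r/2) * (h j powr (r/2) * c i j))"
    by (subst sum.swap) (simp add: algebra_simps)
  also have "\<dots> = (r/2) * (\<Sum>j\<in>UNIV. h j powr (r/2 - 1) * (\<Sum>i\<in>UNIV. c i j * l i)) + (1 - r/2) * (\<Sum>j\<in>UNIV. h j powr (r/2) * (\<Sum>i\<in>UNIV. c i j))"
    by (simp only: sum.distrib sum_distrib_left)
  also have "(\<lambda>j. \<Sum>i\<in>UNIV. c i j * l i) = (\<lambda>j. (norm (w j v* N))\<^sup>2)"
    by (simp add: c_def l_def norm_vector_matrix_left_singular_basis[OF u, symmetric])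
  finally show ?thesis
    by (simp add: l ci)
qed

section \<open>Homogeneity, Hoelder duality and continuity of Schatten norms\<close>

lemma left_singular_basis_scaleR:
  "left_singular_basis u Z \<Longrightarrow> left_singular_basis u (t *\<^sub>R Z)"
  by (simp add: left_singular_basis_def vector_scaleR_matrix_ac)

lemma schatten_norm_nonneg: "0 \<le> schatten_norm r Z"
proof -
  obtain u where "left_singular_basis u Z"
    using left_singular_basis_exists .
  then show ?thesis
    by (simp add: schatten_norm_left_singular_basis) (auto simp: Max_ge_iff)
qed

lemma schatten_norm_scaleR:
  assumes "1 \<le> r"
  shows "schatten_norm r (t *\<^sub>R Z) = \<bar>t\<bar> * schatten_norm r Z"
proof -
  obtain u where u: "left_singular_basis u Z"
    using left_singular_basis_exists .
  show ?thesis
  proof (cases "r = \<infinity>")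
    case True
    have "mono (\<lambda>x. \<bar>t\<bar> * x)"
      by (auto intro!: monoI mult_left_mono)
    from mono_Max_commute[OF this, of "range (\<lambda>i. norm (u i v* Z))"]
    show ?thesis
      using True by (simp add: schatten_norm_left_singular_basis[OF u] image_image
        schatten_norm_left_singular_basis[OF left_singular_basis_scaleR[OF u]] vector_scaleR_matrix_ac)
  next
    case False
    then obtain s where s: "r = ereal s" "1 \<le> s"
      using assms by (cases r) auto
    have "(\<Sum>i\<in>UNIV. (\<bar>t\<bar> * norm (u i v* Z)) powr s) powr (1/s)
        = (\<bar>t\<bar> powr s * (\<Sum>i\<in>UNIV. norm (u i v* Z) powr s)) powr (1/s)"
      by (simp add: powr_mult sum_distrib_left)
    also have "\<dots> = \<bar>t\<bar> * (\<Sum>i\<in>UNIV. norm (u i v* Z) powr s) powr (1/s)"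
      using s by (simp add: powr_mult powr_powr sum_nonneg)
    finally show ?thesis
      using s by (simp add: schatten_norm_left_singular_basis[OF u]
        schatten_norm_left_singular_basis[OF left_singular_basis_scaleR[OF u]] vector_scaleR_matrix_ac)
  qed
qed

locale schatten_dual_pair =
  fixes p q :: ereal
  assumes p: "2 \<le> p" and q: "1 \<le> q" "q \<le> 2" and conj: "1 / p + 1 / q = 1"
begin

text \<open>The power sums need real exponents; the only pair with an infinite member is the pair of
  \<open>\<infinity>\<close> and 1, and a finite \<open>p\<close> forces
  \<open>q > 1\<close>.\<close>

lemma conj_cases:
  obtains (infinity) "p = \<infinity>" "q = 1"
    | (finite) s r where "p = ereal s" "q = ereal r" "2 \<le> s" "1 < r" "r \<le> 2" "1 / r + 1 / s = 1"
proof -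
  obtain r where r: "q = ereal r" "1 \<le> r" "r \<le> 2"
    using q by (cases q) auto
  consider "p = \<infinity>" | s where "p = ereal s" "2 \<le> s"
    using p by (cases p) auto
  then show ?thesis
  proof cases
    case 1
    then have "ereal (1 / r) = 1"
      using conj r by (simp add: one_ereal_def)
    then show ?thesis
      using that(1) 1 r by (simp add: one_ereal_def)
  next
    case 2
    then have "1 / r + 1 / s = 1"
      using conj r by (simp add: one_ereal_def add.commute)
    moreover from this have "1 < r"
      using 2 r by (cases "r = 1") auto
    ultimately show ?thesis
      using that(2) 2 r by blast
  qed
qed

lemma p_ge_1: "1 \<le> p"
  using p by (rule order_trans[rotated]) simp

text \<open>Cauchy-Schwarz in each direction of the left singular basis \<open>u\<close> of
  \<open>A\<close> reduces the claim to Hoelder for the numbers \<open>a i\<close> and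
  \<open>b i\<close>. The \<open>b i\<close> are not singular values of \<open>B\<close>, but their
  squares are doubly stochastic averages of the squared singular values. As
  \<open>p \<ge> 2\<close>, the power \<open>s / 2\<close> is convex and Jensen bounds the
  \<open>b i\<close> by the singular values; this takes the place of von Neumann's trace
  inequality.\<close>

lemma schatten_norm_holder:
  fixes A B :: "real^'n^'m"
  shows "A \<bullet> B \<le> schatten_norm q A * schatten_norm p B"
proof -
  obtain u where u: "left_singular_basis u A"
    using left_singular_basis_exists .
  obtain w where w: "left_singular_basis w B"
    using left_singular_basis_exists .
  define a b where "a i = norm (u i v* A)" and "b i = norm (u i v* B)" for i
  define t where "t j = norm (w j v* B)" for j
  define c where "c i j = (w j \<bullet> u i)\<^sup>2" for i j
  have uw: "orthonormal u" "orthonormal w"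
    using u w by (auto simp: left_singular_basis_def)
  have cj: "(\<Sum>j\<in>UNIV. c i j) = 1" and ci: "(\<Sum>i\<in>UNIV. c i j) = 1" for i j
    using orthonormal_sum_squares[OF uw, of i] orthonormal_sum_squares[OF uw(2,1), of j]
    by (simp_all add: c_def inner_commute)
  have b: "(b i)\<^sup>2 = (\<Sum>j\<in>UNIV. c i j * (t j)\<^sup>2)" for i
    by (simp add: b_def c_def t_def norm_vector_matrix_left_singular_basis[OF w, of "u i"])
  have "A \<bullet> B = (\<Sum>i\<in>UNIV. (u i v* A) \<bullet> (u i v* B))"
    by (simp add: orthonormal_inner_matrix[OF uw(1)])
  also have "\<dots> \<le> (\<Sum>i\<in>UNIV. a i * b i)"
    unfolding a_def b_def by (intro sum_mono norm_cauchy_schwarz)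
  finally have AB: "A \<bullet> B \<le> (\<Sum>i\<in>UNIV. a i * b i)" .
  show ?thesis
  proof (cases rule: conj_cases)
    case infinity
    let ?T = "MAX j. t j"
    have T: "t j \<le> ?T" "0 \<le> t j" for j
      by (auto simp: t_def intro!: Max_ge)
    then have T0: "0 \<le> ?T"
      using order_trans by blast
    \<comment> \<open>Each \<open>(b i)\<^sup>2\<close> is a convex combination of squared singular
      values of \<open>B\<close>.\<close>
    have "b i \<le> ?T" for i
    proof (rule power2_le_imp_le[OF _ T0])
      have "(b i)\<^sup>2 \<le> (\<Sum>j\<in>UNIV. c i j * ?T\<^sup>2)"
        unfolding b using T by (intro sum_mono mult_left_mono power_mono) (auto simp: c_def)
      then show "(b i)\<^sup>2 \<le> ?T\<^sup>2"
        by (simp add: sum_distrib_right[symmetric] cj)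
    qed
    then have "(\<Sum>i\<in>UNIV. a i * b i) \<le> (\<Sum>i\<in>UNIV. a i * ?T)"
      by (intro sum_mono mult_left_mono) (auto simp: a_def)
    then show ?thesis
      using AB infinity
      by (simp add: schatten_norm_left_singular_basis[OF u] schatten_norm_left_singular_basis[OF w]
          a_def t_def sum_distrib_right sum_nonneg)
  next
    case (finite s r)
    have "(\<Sum>i\<in>UNIV. b i powr s) = (\<Sum>i\<in>UNIV. (\<Sum>j\<in>UNIV. c i j * (t j)\<^sup>2) powr (s / 2))"
      by (simp add: b[symmetric] power2_powr_half b_def)
    also have "\<dots> \<le> (\<Sum>i\<in>UNIV. \<Sum>j\<in>UNIV. c i j * ((t j)\<^sup>2) powr (s / 2))"
      using finite cj by (intro sum_mono powr_weighted_mean_le) (auto simp: c_def)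
    also have "\<dots> = (\<Sum>j\<in>UNIV. (\<Sum>i\<in>UNIV. c i j) * t j powr s)"
      by (subst sum.swap) (simp add: sum_distrib_right power2_powr_half t_def)
    finally have "(\<Sum>i\<in>UNIV. b i powr s) \<le> (\<Sum>j\<in>UNIV. t j powr s)"
      by (simp add: ci)
    then have "(\<Sum>i\<in>UNIV. b i powr s) powr (1 / s) \<le> (\<Sum>j\<in>UNIV. t j powr s) powr (1 / s)"
      using finite by (intro powr_mono2) (auto intro!: sum_nonneg)
    moreover have "(\<Sum>i\<in>UNIV. a i * b i) \<le> (\<Sum>i\<in>UNIV. a i powr r) powr (1/r) * (\<Sum>i\<in>UNIV. b i powr s) powr (1 / s)"
      using finite by (intro holder_sum_powr) (auto simp: a_def b_def)
    ultimately have "(\<Sum>i\<in>UNIV. a i * b i) \<le> (\<Sum>i\<in>UNIV. a i powr r) powr (1/r) * (\<Sum>j\<in>UNIV. t j powr s) powr (1 / s)"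
      by (meson mult_left_mono order_trans powr_ge_zero)
    then show ?thesis
      using AB finite
      by (simp add: schatten_norm_left_singular_basis[OF u] schatten_norm_left_singular_basis[OF w]
          a_def t_def)
  qed
qed

text \<open>The witness is the sum of the rank-one matrices with column \<open>u i\<close> and row
  \<open>d i *\<^sub>R (u i v* A)\<close>. It serves to prescribe singular values without changing
  singular directions.\<close>

lemma left_singular_basis_rescale:
  fixes A :: "real^'n^'m"
  assumes u: "left_singular_basis u A"
  obtains C where "left_singular_basis u C" "\<And>i. u i v* C = d i *\<^sub>R (u i v* A)"
proof -
  have u': "orthonormal u"
    using u by (simp add: left_singular_basis_def)
  define C where "C = (\<chi> k l. \<Sum>i\<in>UNIV. u i $ k * (d i * (u i v* A) $ l))"
  have C: "u j v* C = d j *\<^sub>R (u j v* A)" for j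
  proof -
    have "(u j v* C) $ l = d j * (u j v* A) $ l" for l
    proof -
      have "(u j v* C) $ l = (\<Sum>k\<in>UNIV. u j $ k * C $ k $ l)"
        by (simp add: vector_matrix_mult_def)
      also have "\<dots> = (\<Sum>k\<in>UNIV. \<Sum>i\<in>UNIV. (u j $ k * u i $ k) * (d i * (u i v* A) $ l))"
        by (simp add: C_def sum_distrib_left mult.assoc)
      also have "\<dots> = (\<Sum>i\<in>UNIV. (u j \<bullet> u i) * (d i * (u i v* A) $ l))"
        by (subst sum.swap) (simp add: sum_distrib_right inner_vec_def)
      finally show ?thesis
        using u' by (simp add: orthonormal_def)
    qed
    then show ?thesis
      by (simp add: vec_eq_iff)
  qed
  show ?thesis
    using u by (intro that[of C]) (auto simp: C left_singular_basis_def)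
qed

text \<open>The maximizer keeps the singular directions of \<open>A\<close> and takes the singular
  values of the equality case of Hoelder: 1 for \<open>q = 1\<close>, and
  \<open>(a i / t) powr (r - 1)\<close> otherwise. All of them are at most 1, which gives the
  Frobenius bound used later for continuity.\<close>

lemma schatten_norm_dual:
  fixes A :: "real^'n^'m"
  obtains C where "schatten_norm p C \<le> 1" "A \<bullet> C = schatten_norm q A" "norm C \<le> sqrt (real CARD('m))"
proof -
  obtain u where u: "left_singular_basis u A"
    using left_singular_basis_exists .
  then have u': "orthonormal u"
    by (simp add: left_singular_basis_def)
  define a where "a i = norm (u i v* A)" for i
  have a0: "0 \<le> a i" for i
    by (simp add: a_def)
  define t where "t = schatten_norm q A"
  \<comment> \<open>The \<open>e i\<close> are the intended singular values of \<open>C\<close>.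
    Where \<open>a i = 0\<close> there is no direction to rescale, so \<open>C\<close> vanishes
    there; such indices contribute nothing to the sum.\<close>
  obtain e where e: "\<And>i. 0 \<le> e i" "\<And>i. e i \<le> 1" "(\<Sum>i\<in>UNIV. a i * e i) = t"
    "\<And>C :: real^'n^'m. left_singular_basis u C \<Longrightarrow> (\<And>i. norm (u i v* C) = (if a i = 0 then 0 else e i)) \<Longrightarrow> schatten_norm p C \<le> 1"
  proof (cases rule: conj_cases)
    case infinity
    show ?thesis
    proof (rule that[of "\<lambda>_. 1"])
      show "(\<Sum>i\<in>UNIV. a i * 1) = t"
        using infinity by (simp add: t_def schatten_norm_left_singular_basis[OF u] a_def sum_nonneg)
      fix C :: "real^'n^'m" assume C: "left_singular_basis u C"
        "\<And>i. norm (u i v* C) = (if a i = 0 then 0 else 1)"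
      have "schatten_norm p C = (MAX i. norm (u i v* C))"
        by (simp add: schatten_norm_left_singular_basis[OF C(1)] infinity)
      also have "\<dots> \<le> 1"
        by (rule Max.boundedI) (auto simp: C(2))
      finally show "schatten_norm p C \<le> 1" .
    qed auto
  next
    case (finite s r)
    have t: "t powr r = (\<Sum>i\<in>UNIV. a i powr r)" and "0 \<le> t"
      using finite by (simp_all add: t_def schatten_norm_left_singular_basis[OF u] a_def powr_powr sum_nonneg)
    \<comment> \<open>Conjugacy in this form turns the \<open>s\<close>-th powers of the dual values
      into the \<open>r\<close>-th powers of the singular values of \<open>A\<close>.\<close>
    have rs: "(r - 1) * s = r"
      using finite by (simp add: field_simps)
    have at: "a i \<le> t" for i
    proof -
      have "a i powr r \<le> (\<Sum>i\<in>UNIV. a i powr r)"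
        by (rule member_le_sum) auto
      then have "a i powr r \<le> t powr r"
        by (simp add: t)
      then show ?thesis
        using finite a0 \<open>0 \<le> t\<close> by (meson not_le order_le_less_trans powr_less_mono2 less_trans zero_less_one)
    qed
    show ?thesis
    proof (cases "t = 0")
      case True
      with at a0 have "a i = 0" for i
        by (metis order_antisym)
      then show ?thesis
        using True finite by (intro that[of "\<lambda>_. 0"]) (auto simp: schatten_norm_left_singular_basis)
    next
      case False
      with \<open>0 \<le> t\<close> have "t > 0"
        by simp
      show ?thesis
      proof (rule that[of "\<lambda>i. (a i / t) powr (r - 1)"])
        show "(a i / t) powr (r - 1) \<le> 1" for i
          using at[of i] a0[of i] \<open>t > 0\<close> finite by (intro powr_le1) auto
        have "(\<Sum>i\<in>UNIV. a i * (a i / t) powr (r - 1)) = (\<Sum>i\<in>UNIV. a i powr r) / t powr (r - 1)"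
          using a0 \<open>t > 0\<close> by (simp add: powr_divide powr_mult_base sum_divide_distrib)
        also have "\<dots> = t powr r / t powr (r - 1)"
          by (simp add: t)
        also have "\<dots> = t"
          using \<open>t > 0\<close> by (simp add: powr_diff[symmetric])
        finally show "(\<Sum>i\<in>UNIV. a i * (a i / t) powr (r - 1)) = t" .
      next
        fix C :: "real^'n^'m" assume C: "left_singular_basis u C"
          "\<And>i. norm (u i v* C) = (if a i = 0 then 0 else (a i / t) powr (r - 1))"
        have C': "norm (u i v* C) = (a i / t) powr (r - 1)" for i
          using C(2)[of i] by simp
        have "(\<Sum>i\<in>UNIV. norm (u i v* C) powr s) = (\<Sum>i\<in>UNIV. a i powr r) / t powr r"
          using a0 \<open>t > 0\<close> by (simp add: C' powr_powr rs powr_divide sum_divide_distrib)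
        then show "schatten_norm p C \<le> 1"
          using finite \<open>t > 0\<close> by (simp add: schatten_norm_left_singular_basis[OF C(1)] t[symmetric])
      qed auto
    qed
  qed
  \<comment> \<open>For \<open>a i = 0\<close> the quotient \<open>e i / a i\<close> is 0 by
    convention, as required by the fourth property of \<open>e\<close>.\<close>
  obtain C where C: "left_singular_basis u C" "\<And>i. u i v* C = (e i / a i) *\<^sub>R (u i v* A)"
    using left_singular_basis_rescale[OF u, of "\<lambda>i. e i / a i"] by blast
  have nC: "norm (u i v* C) = (if a i = 0 then 0 else e i)" for i
    using e(1)[of i] a0[of i] by (simp add: C(2) a_def)
  have "A \<bullet> C = (\<Sum>i\<in>UNIV. (u i v* A) \<bullet> (u i v* C))"
    by (simp add: orthonormal_inner_matrix[OF u'])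
  also have "\<dots> = (\<Sum>i\<in>UNIV. a i * e i)"
    by (intro sum.cong) (auto simp: C(2) a_def power2_eq_square simp flip: power2_norm_eq_inner)
  finally have "A \<bullet> C = t"
    by (simp add: e(3))
  moreover have "(norm C)\<^sup>2 \<le> real CARD('m)"
  proof -
    have "(norm C)\<^sup>2 = (\<Sum>i\<in>UNIV. (norm (u i v* C))\<^sup>2)"
      using orthonormal_inner_matrix[OF u', of C C] by (simp add: power2_norm_eq_inner)
    also have "\<dots> \<le> (\<Sum>i\<in>(UNIV::'m set). 1)"
      using e(1,2) by (intro sum_mono) (auto simp: nC power_le_one)
    finally show ?thesis
      by simp
  qed
  ultimately show ?thesis
    using that[of C] e(4)[OF C(1) nC] by (simp add: t_def real_le_rsqrt)
qed

text \<open>The dual matrix of \<open>A + B\<close> is tested against both summands, each time with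
  Hoelder.\<close>

lemma schatten_norm_triangle:
  fixes A B :: "real^'n^'m"
  shows "schatten_norm q (A + B) \<le> schatten_norm q A + schatten_norm q B"
proof -
  obtain C where C: "schatten_norm p C \<le> 1" "(A + B) \<bullet> C = schatten_norm q (A + B)"
    using schatten_norm_dual by metis
  have "A' \<bullet> C \<le> schatten_norm q A'" for A'
    using schatten_norm_holder[of A' C] mult_left_mono[OF C(1) schatten_norm_nonneg[of q A']] by simp
  from this[of A] this[of B] show ?thesis
    using C(2) by (simp add: inner_add_left)
qed

lemma schatten_norm_le_norm:
  fixes A :: "real^'n^'m"
  shows "schatten_norm q A \<le> sqrt (real CARD('m)) * norm A"
proof -
  obtain C where C: "A \<bullet> C = schatten_norm q A" "norm C \<le> sqrt (real CARD('m))"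
    using schatten_norm_dual by metis
  have "A \<bullet> C \<le> norm A * norm C"
    by (rule norm_cauchy_schwarz)
  also have "\<dots> \<le> norm A * sqrt (real CARD('m))"
    using C by (intro mult_left_mono) auto
  finally show ?thesis
    using C by (simp add: mult.commute)
qed

text \<open>The triangle inequality and the comparison with the Frobenius norm give a Lipschitz
  bound; continuity is what supplies measurability of the norms under expectation.\<close>

lemma continuous_on_schatten_norm: "continuous_on UNIV (schatten_norm q :: real^'n^'m \<Rightarrow> real)"
proof (rule lipschitz_on_continuous_on[of "sqrt (real CARD('m))"], rule lipschitz_onI)
  fix A B :: "real^'n^'m"
  have "schatten_norm q A - schatten_norm q B \<le> sqrt (real CARD('m)) * norm (A - B)" for A B :: "real^'n^'m"
    using schatten_norm_triangle[of "A - B" B] schatten_norm_le_norm[of "A - B"] by simp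
  from this[of A B] this[of B A]
  show "dist (schatten_norm q A) (schatten_norm q B) \<le> sqrt (real CARD('m)) * dist A B"
    by (simp add: dist_norm norm_minus_commute)
qed simp

lemma borel_measurable_schatten_norm [measurable]:
  "(schatten_norm q :: real^'n^'m \<Rightarrow> real) \<in> borel_measurable borel"
  by (intro borel_measurable_continuous_onI continuous_on_schatten_norm)

end

section \<open>Independence and adapted random variables\<close>

text \<open>An arbitrary index set \<open>J\<close>, rather than a filtration in time, also allows
  removing a single sample from the current batch.\<close>

definition generated_by :: "'w measure \<Rightarrow> 'x measure \<Rightarrow> ('e \<Rightarrow> 'w \<Rightarrow> 'x) \<Rightarrow> 'e set \<Rightarrow> 'w measure" where
  "generated_by P \<Xi> Y J = sigma (space P) {Y e -` A \<inter> space P | e A. e \<in> J \<and> A \<in> sets \<Xi>}"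

lemma space_generated_by [simp]: "space (generated_by P \<Xi> Y J) = space P"
  by (simp add: generated_by_def space_measure_of_conv)

lemma sets_generated_by:
  "sets (generated_by P \<Xi> Y J) = sigma_sets (space P) {Y e -` A \<inter> space P | e A. e \<in> J \<and> A \<in> sets \<Xi>}"
  unfolding generated_by_def by (rule sets_measure_of) auto

lemma measurable_generated_by_mono:
  assumes "J \<subseteq> J'" "U \<in> measurable (generated_by P \<Xi> Y J) N"
  shows "U \<in> measurable (generated_by P \<Xi> Y J') N"
proof -
  have "sets (generated_by P \<Xi> Y J) \<subseteq> sets (generated_by P \<Xi> Y J')"
    unfolding sets_generated_by using assms(1) by (intro sigma_sets_mono') auto
  then show ?thesis
    using assms(2) measurable_mono[of N N "generated_by P \<Xi> Y J" "generated_by P \<Xi> Y J'"] by auto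
qed

lemma measurable_generated_by_component:
  assumes "e \<in> J" "Y e \<in> measurable P \<Xi>"
  shows "Y e \<in> measurable (generated_by P \<Xi> Y J) \<Xi>"
proof (rule measurableI)
  show "Y e \<omega> \<in> space \<Xi>" if "\<omega> \<in> space (generated_by P \<Xi> Y J)" for \<omega>
    using that measurable_space[OF assms(2)] by simp
  show "Y e -` A \<inter> space (generated_by P \<Xi> Y J) \<in> sets (generated_by P \<Xi> Y J)" if "A \<in> sets \<Xi>" for A
    using that assms(1) unfolding sets_generated_by space_generated_by
    by (intro sigma_sets.Basic) auto
qed

lemma measurable_from_generated_by:
  assumes "\<And>e. e \<in> J \<Longrightarrow> Y e \<in> measurable P \<Xi>" "U \<in> measurable (generated_by P \<Xi> Y J) N"
  shows "U \<in> measurable P N"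
proof -
  have "sets (generated_by P \<Xi> Y J) \<subseteq> sets P"
    unfolding sets_generated_by using assms(1) by (intro sets.sigma_sets_subset) (auto intro: measurable_sets)
  then show ?thesis
    using assms(2) measurable_mono[of N N "generated_by P \<Xi> Y J" P] by auto
qed

section \<open>Fresh samples: joint laws, moment bounds and orthogonality\<close>

context prob_space
begin

text \<open>Grouping independent families keeps them independent, so the sigma-algebra of
  \<open>J\<close> is independent of \<open>Y e\<close>; the product law is then identified on
  rectangles.\<close>

lemma joint_distr_generated_by:
  assumes indep: "indep_vars (\<lambda>_. \<Xi>) Y I" and J: "J \<subseteq> I" "e \<in> I" "e \<notin> J"
    and U: "U \<in> measurable (generated_by M \<Xi> Y J) N"
  shows "distr M (N \<Otimes>\<^sub>M \<Xi>) (\<lambda>\<omega>. (U \<omega>, Y e \<omega>)) = distr M N U \<Otimes>\<^sub>M distr M \<Xi> (Y e)"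
proof -
  define E where "E = (\<lambda>i. {Y i -` A \<inter> space M | A. A \<in> sets \<Xi>})"
  \<comment> \<open>The two groups are indexed by \<open>bool\<close> to match the encoding of
    \<open>indep_set\<close>.\<close>
  define S where "S b = (if b then J else {e})" for b
  have rv: "\<And>i. i \<in> I \<Longrightarrow> Y i \<in> measurable M \<Xi>" and E: "indep_sets E I"
    using indep by (auto simp: indep_vars_def2 E_def)
  have "indep_sets (\<lambda>b. sigma_sets (space M) (\<Union>i\<in>S b. E i)) UNIV"
  proof (rule indep_sets_collect_sigma)
    show "indep_sets E (\<Union>b\<in>UNIV. S b)"
      using J by (intro indep_sets_mono_index[OF _ E]) (auto simp: S_def split: if_splits)
    show "Int_stable (E i)" for i
      unfolding E_def Int_stable_def by (auto, rule_tac x="A \<inter> Aa" in exI, auto)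
    show "disjoint_family_on S UNIV"
      using J by (auto simp: disjoint_family_on_def S_def)
  qed
  then have indep_set: "indep_set (sigma_sets (space M) (\<Union>i\<in>J. E i)) (sigma_sets (space M) (E e))"
    unfolding indep_set_def by (rule indep_sets_mono_sets) (simp add: S_def split: bool.split)
  have UE: "(\<Union>i\<in>J. E i) = {Y i -` A \<inter> space M | i A. i \<in> J \<and> A \<in> sets \<Xi>}"
    by (auto simp: E_def)
  have ind: "prob (a \<inter> b) = prob a * prob b"
    if "a \<in> sets (generated_by M \<Xi> Y J)" "b \<in> E e" for a b
    using that by (intro indep_setD[OF indep_set]) (auto simp: sets_generated_by UE)
  have [measurable]: "U \<in> measurable M N" "Y e \<in> measurable M \<Xi>"
    using measurable_from_generated_by[OF _ U] rv J by auto
  interpret D: prob_space "distr M N U"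
    by (rule prob_space_distr) simp
  interpret F: prob_space "distr M \<Xi> (Y e)"
    by (rule prob_space_distr) simp
  show ?thesis
  proof (rule pair_measure_eqI[symmetric])
    fix A C assume "A \<in> sets (distr M N U)" "C \<in> sets (distr M \<Xi> (Y e))"
    then have AC [measurable]: "A \<in> sets N" "C \<in> sets \<Xi>"
      by simp_all
    have eq: "(\<lambda>\<omega>. (U \<omega>, Y e \<omega>)) -` (A \<times> C) \<inter> space M = (U -` A \<inter> space M) \<inter> (Y e -` C \<inter> space M)"
      by auto
    have "prob ((U -` A \<inter> space M) \<inter> (Y e -` C \<inter> space M)) = prob (U -` A \<inter> space M) * prob (Y e -` C \<inter> space M)"
      using measurable_sets[OF U AC(1)] AC(2) by (intro ind) (auto simp: E_def)
    then show "emeasure (distr M N U) A * emeasure (distr M \<Xi> (Y e)) C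
        = emeasure (distr M (N \<Otimes>\<^sub>M \<Xi>) (\<lambda>\<omega>. (U \<omega>, Y e \<omega>))) (A \<times> C)"
      by (simp add: emeasure_distr eq emeasure_eq_measure ennreal_mult)
  qed (simp_all add: D.sigma_finite_measure_axioms F.sigma_finite_measure_axioms cong: sets_pair_measure_cong)
qed

text \<open>Under the product law the past \<open>U\<close> can be frozen and the new sample
  integrated first. The nonnegative integral is used because finiteness, and hence integrability, is
  to be deduced from this bound.\<close>

lemma nn_integral_joint_le:
  assumes U [measurable]: "U \<in> measurable M N" and Y [measurable]: "Y \<in> measurable M \<Xi>"
    and joint: "distr M (N \<Otimes>\<^sub>M \<Xi>) (\<lambda>\<omega>. (U \<omega>, Y \<omega>)) = distr M N U \<Otimes>\<^sub>M distr Q \<Xi> \<xi>"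
    and Q: "prob_space Q" and \<xi>: "\<xi> \<in> measurable Q \<Xi>"
    and g: "g \<in> borel_measurable (N \<Otimes>\<^sub>M \<Xi>)"
    and le: "\<And>u. u \<in> space N \<Longrightarrow> (\<integral>\<^sup>+z. g (u, \<xi> z) \<partial>Q) \<le> c"
  shows "(\<integral>\<^sup>+\<omega>. g (U \<omega>, Y \<omega>) \<partial>M) \<le> c"
proof -
  interpret D: prob_space "distr M N U"
    by (rule prob_space_distr) simp
  interpret E: prob_space "distr Q \<Xi> \<xi>"
    using Q \<xi> by (rule prob_space.prob_space_distr)
  note [measurable] = g \<xi>
  have "(\<integral>\<^sup>+\<omega>. g (U \<omega>, Y \<omega>) \<partial>M) = (\<integral>\<^sup>+x. g x \<partial>distr M (N \<Otimes>\<^sub>M \<Xi>) (\<lambda>\<omega>. (U \<omega>, Y \<omega>)))"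
    by (simp add: nn_integral_distr)
  also have "\<dots> = (\<integral>\<^sup>+u. \<integral>\<^sup>+x. g (u, x) \<partial>distr Q \<Xi> \<xi> \<partial>distr M N U)"
    unfolding joint by (rule E.nn_integral_fst[symmetric]) simp
  also have "\<dots> \<le> (\<integral>\<^sup>+u. c \<partial>distr M N U)"
    using le by (intro nn_integral_mono) (simp add: nn_integral_distr)
  also have "\<dots> = c"
    using D.emeasure_space_1 by simp
  finally show ?thesis .
qed

text \<open>Fubini on the product law: for a fixed past the factor \<open>h u\<close> leaves the
  inner integral, which vanishes by the zero mean. This is orthogonality of martingale differences
  without conditional expectations.\<close>

lemma integral_inner_joint_eq_0:
  fixes h :: "'u \<Rightarrow> 'b::euclidean_space"
  assumes U [measurable]: "U \<in> measurable M N" and Y [measurable]: "Y \<in> measurable M \<Xi>"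
    and joint: "distr M (N \<Otimes>\<^sub>M \<Xi>) (\<lambda>\<omega>. (U \<omega>, Y \<omega>)) = distr M N U \<Otimes>\<^sub>M distr Q \<Xi> \<xi>"
    and Q: "prob_space Q" and \<xi>: "\<xi> \<in> measurable Q \<Xi>"
    and g: "g \<in> borel_measurable (N \<Otimes>\<^sub>M \<Xi>)" and h: "h \<in> borel_measurable N"
    and int: "integrable M (\<lambda>\<omega>. h (U \<omega>) \<bullet> g (U \<omega>, Y \<omega>))"
    and mean: "\<And>u. u \<in> space N \<Longrightarrow> integrable Q (\<lambda>z. g (u, \<xi> z))"
      "\<And>u. u \<in> space N \<Longrightarrow> (\<integral>z. g (u, \<xi> z) \<partial>Q) = 0"
  shows "(\<integral>\<omega>. h (U \<omega>) \<bullet> g (U \<omega>, Y \<omega>) \<partial>M) = 0"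
proof -
  interpret D: prob_space "distr M N U"
    by (rule prob_space_distr) simp
  interpret E: prob_space "distr Q \<Xi> \<xi>"
    using Q \<xi> by (rule prob_space.prob_space_distr)
  interpret DE: pair_sigma_finite "distr M N U" "distr Q \<Xi> \<xi>" ..
  note [measurable] = g h \<xi>
  define F where "F x = h (fst x) \<bullet> g x" for x
  have F[measurable]: "F \<in> borel_measurable (N \<Otimes>\<^sub>M \<Xi>)"
    unfolding F_def by measurable
  have int': "integrable (distr M N U \<Otimes>\<^sub>M distr Q \<Xi> \<xi>) F"
    unfolding joint[symmetric] using int
    by (subst integrable_distr_eq) (simp_all add: F_def)
  have "(\<integral>\<omega>. h (U \<omega>) \<bullet> g (U \<omega>, Y \<omega>) \<partial>M) = (\<integral>x. F x \<partial>distr M (N \<Otimes>\<^sub>M \<Xi>) (\<lambda>\<omega>. (U \<omega>, Y \<omega>)))"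
    by (subst integral_distr) (simp_all add: F_def)
  also have "\<dots> = (\<integral>u. \<integral>x. F (u, x) \<partial>distr Q \<Xi> \<xi> \<partial>distr M N U)"
    unfolding joint by (rule DE.integral_fst'[symmetric, OF int'])
  also have "\<dots> = (\<integral>u. 0 \<partial>distr M N U)"
  proof (rule Bochner_Integration.integral_cong[OF refl])
    fix u assume "u \<in> space (distr M N U)"
    then have u: "u \<in> space N" by simp
    have "(\<lambda>x. F (u, x)) \<in> borel_measurable \<Xi>"
      by (rule measurable_compose[OF measurable_Pair1'[OF u] F])
    then have "(\<integral>x. F (u, x) \<partial>distr Q \<Xi> \<xi>) = (\<integral>z. h u \<bullet> g (u, \<xi> z) \<partial>Q)"
      using \<xi> by (simp add: integral_distr F_def)
    also have "\<dots> = 0"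
      using mean[OF u] by simp
    finally show "(\<integral>x. F (u, x) \<partial>distr Q \<Xi> \<xi>) = 0" .
  qed
  finally show ?thesis
    by simp
qed

text \<open>The square is expanded and the cross terms vanish. The hypothesis \<open>orth\<close>
  may assume integrability of the products, since the second moment bounds supply it inside the
  proof.\<close>

lemma second_moment_orthogonal_sum:
  fixes Z :: "'e \<Rightarrow> 'a \<Rightarrow> 'b::euclidean_space"
  assumes "finite I" and Z: "\<And>e. e \<in> I \<Longrightarrow> Z e \<in> borel_measurable M"
    and le: "\<And>e. e \<in> I \<Longrightarrow> (\<integral>\<^sup>+\<omega>. ennreal ((norm (Z e \<omega>))\<^sup>2) \<partial>M) \<le> ennreal c" and c: "0 \<le> c"
    and orth: "\<And>e e'. e \<in> I \<Longrightarrow> e' \<in> I \<Longrightarrow> e \<noteq> e' \<Longrightarrow> integrable M (\<lambda>\<omega>. Z e \<omega> \<bullet> Z e' \<omega>) \<Longrightarrow>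
      (\<integral>\<omega>. Z e \<omega> \<bullet> Z e' \<omega> \<partial>M) = 0"
  shows "integrable M (\<lambda>\<omega>. (norm (\<Sum>e\<in>I. a e *\<^sub>R Z e \<omega>))\<^sup>2)"
    and "(\<integral>\<omega>. (norm (\<Sum>e\<in>I. a e *\<^sub>R Z e \<omega>))\<^sup>2 \<partial>M) \<le> (\<Sum>e\<in>I. (a e)\<^sup>2) * c"
proof -
  note [measurable] = Z
  have sq: "integrable M (\<lambda>\<omega>. (norm (Z e \<omega>))\<^sup>2)" if e: "e \<in> I" for e
    using le[OF e] e by (intro integrableI_bounded) (auto intro: le_less_trans)
  have sq_le: "(\<integral>\<omega>. (norm (Z e \<omega>))\<^sup>2 \<partial>M) \<le> c" if e: "e \<in> I" for e
    using le[OF e] c sq[OF e] by (subst (asm) nn_integral_eq_integral) auto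
  have inner: "integrable M (\<lambda>\<omega>. Z e \<omega> \<bullet> Z e' \<omega>)" if e: "e \<in> I" "e' \<in> I" for e e'
  proof (rule Bochner_Integration.integrable_bound)
    show "integrable M (\<lambda>\<omega>. (norm (Z e \<omega>))\<^sup>2 + (norm (Z e' \<omega>))\<^sup>2)"
      using sq e by simp
    have "\<bar>x \<bullet> y\<bar> \<le> (norm x)\<^sup>2 + (norm y)\<^sup>2" for x y :: 'b
      using Cauchy_Schwarz_ineq2[of x y] sum_squares_bound[of "norm x" "norm y"]
        mult_nonneg_nonneg[OF norm_ge_zero norm_ge_zero, of x y] by linarith
    then show "AE \<omega> in M. norm (Z e \<omega> \<bullet> Z e' \<omega>) \<le> norm ((norm (Z e \<omega>))\<^sup>2 + (norm (Z e' \<omega>))\<^sup>2)"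
      by simp
  qed (use e in measurable)
  have expand: "(norm (\<Sum>e\<in>I. a e *\<^sub>R Z e \<omega>))\<^sup>2 = (\<Sum>e\<in>I. \<Sum>e'\<in>I. a e * a e' * (Z e' \<omega> \<bullet> Z e \<omega>))" for \<omega>
    by (simp add: power2_norm_eq_inner inner_sum_left inner_sum_right sum_distrib_left mult.assoc mult.left_commute inner_commute)
  show "integrable M (\<lambda>\<omega>. (norm (\<Sum>e\<in>I. a e *\<^sub>R Z e \<omega>))\<^sup>2)"
    unfolding expand using inner by simp
  have "(\<integral>\<omega>. (norm (\<Sum>e\<in>I. a e *\<^sub>R Z e \<omega>))\<^sup>2 \<partial>M) = (\<Sum>e\<in>I. \<Sum>e'\<in>I. a e * a e' * (\<integral>\<omega>. Z e' \<omega> \<bullet> Z e \<omega> \<partial>M))"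
    unfolding expand using inner by simp
  also have "\<dots> = (\<Sum>e\<in>I. \<Sum>e'\<in>I. if e' = e then (a e)\<^sup>2 * (\<integral>\<omega>. (norm (Z e \<omega>))\<^sup>2 \<partial>M) else 0)"
    using orth inner by (intro sum.cong refl) (auto simp: power2_norm_eq_inner power2_eq_square[of "a e" for e])
  also have "\<dots> = (\<Sum>e\<in>I. (a e)\<^sup>2 * (\<integral>\<omega>. (norm (Z e \<omega>))\<^sup>2 \<partial>M))"
    using \<open>finite I\<close> by simp
  also have "\<dots> \<le> (\<Sum>e\<in>I. (a e)\<^sup>2 * c)"
    using sq_le by (intro sum_mono mult_left_mono) auto
  finally show "(\<integral>\<omega>. (norm (\<Sum>e\<in>I. a e *\<^sub>R Z e \<omega>))\<^sup>2 \<partial>M) \<le> (\<Sum>e\<in>I. (a e)\<^sup>2) * c"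
    by (simp add: sum_distrib_right)
qed

end

section \<open>Jensen's inequality for the Schatten norm of a random matrix\<close>

lemma bounded_linear_vector_matrix_mult: "bounded_linear (\<lambda>A :: real^'n^'m. w v* A)"
  by (intro linear_conv_bounded_linear[THEN iffD1] linearI) (auto simp: vector_matrix_mult_add_rdistrib vector_scaleR_matrix_ac)

text \<open>Two tangent bounds are chained, one for the trace power \<open>r/2\<close> and one for
  the outer power \<open>1/r\<close>, both taken at the singular values of \<open>V\<close>. The
  resulting majorant is affine in the squared norms of \<open>w j v* N\<close>, whose expectations
  are controlled by \<open>le\<close>.\<close>

lemma (in schatten_dual_pair) expected_schatten_norm_le:
  fixes N :: "'w \<Rightarrow> real^'n^'m" and V :: "real^'k^'m"
  assumes P: "prob_space P" and N: "N \<in> borel_measurable P"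
    and int: "\<And>w. integrable P (\<lambda>\<omega>. (norm (w v* N \<omega>))\<^sup>2)"
    and le: "\<And>w. (\<integral>\<omega>. (norm (w v* N \<omega>))\<^sup>2 \<partial>P) \<le> (norm (w v* V))\<^sup>2"
  shows "integrable P (\<lambda>\<omega>. schatten_norm q (N \<omega>))"
    and "(\<integral>\<omega>. schatten_norm q (N \<omega>) \<partial>P) \<le> schatten_norm q V"
proof -
  interpret prob_space P by fact
  note [measurable] = N
  obtain r where r: "q = ereal r" "1 \<le> r" "r \<le> 2"
    using q by (cases q) auto
  obtain w where w: "left_singular_basis w V"
    using left_singular_basis_exists .
  then have w': "orthonormal w"
    by (simp add: left_singular_basis_def)
  \<comment> \<open>Tangents need positive base points while \<open>V\<close> may be singular; the
    shift by \<open>\<epsilon>\<close> is removed by a limit at the end.\<close>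
  define h where "h \<epsilon> j = (norm (w j v* V))\<^sup>2 + \<epsilon>" for \<epsilon> j
  define t where "t \<epsilon> = (\<Sum>j\<in>UNIV. h \<epsilon> j powr (r/2))" for \<epsilon>
  define R where "R \<epsilon> \<omega> = r/2 * (\<Sum>j\<in>UNIV. h \<epsilon> j powr (r/2 - 1) * (norm (w j v* N \<omega>))\<^sup>2) + (1 - r/2) * t \<epsilon>" for \<epsilon> \<omega>
  \<comment> \<open>\<open>R\<close> is the linearized trace power and \<open>T\<close> the tangent
    of the power \<open>1/r\<close> at \<open>t \<epsilon>\<close>, evaluated at \<open>R\<close>.
    If \<open>R\<close> has mean at most \<open>t \<epsilon>\<close>, then \<open>T\<close> has mean
    at most \<open>t \<epsilon> powr (1/r)\<close>.\<close>
  define T where "T \<epsilon> \<omega> = 1/r * (t \<epsilon> powr (1/r - 1) * R \<epsilon> \<omega>) + (1 - 1/r) * t \<epsilon> powr (1/r)" for \<epsilon> \<omega>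
  have h: "h \<epsilon> j > 0" if "\<epsilon> > 0" for \<epsilon> j
    using that by (simp add: h_def add_nonneg_pos)
  have t: "t \<epsilon> > 0" if "\<epsilon> > 0" for \<epsilon>
    unfolding t_def using h[OF that] by (intro sum_pos) (auto simp: order_less_imp_not_eq2)
  have NT: "schatten_norm q (N \<omega>) \<le> T \<epsilon> \<omega>" if \<epsilon>: "\<epsilon> > 0" for \<epsilon> \<omega>
  proof -
    obtain u where u: "left_singular_basis u (N \<omega>)"
      using left_singular_basis_exists .
    define S where "S = (\<Sum>i\<in>UNIV. norm (u i v* N \<omega>) powr r)"
    have "S \<le> R \<epsilon> \<omega>"
      unfolding S_def R_def t_def using r h[OF \<epsilon>] by (intro sum_powr_singular_values_le u w') auto
    have "schatten_norm q (N \<omega>) = S powr (1/r)"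
      using r by (simp add: schatten_norm_left_singular_basis[OF u] S_def)
    also have "\<dots> \<le> 1/r * (t \<epsilon> powr (1/r - 1) * S) + (1 - 1/r) * t \<epsilon> powr (1/r)"
      using r t[OF \<epsilon>] by (intro powr_tangent) (auto simp: S_def sum_nonneg)
    also have "\<dots> \<le> T \<epsilon> \<omega>"
      unfolding T_def using r \<open>S \<le> R \<epsilon> \<omega>\<close> by (intro add_right_mono mult_left_mono) auto
    finally show ?thesis .
  qed
  have intR: "integrable P (R \<epsilon>)" for \<epsilon>
    unfolding R_def using int by simp
  then have intT: "integrable P (T \<epsilon>)" for \<epsilon>
    unfolding T_def by simp
  show int_norm: "integrable P (\<lambda>\<omega>. schatten_norm q (N \<omega>))"
  proof (rule Bochner_Integration.integrable_bound[OF intT[of 1]])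
    show "AE \<omega> in P. norm (schatten_norm q (N \<omega>)) \<le> norm (T 1 \<omega>)"
    proof (rule AE_I2)
      show "norm (schatten_norm q (N \<omega>)) \<le> norm (T 1 \<omega>)" for \<omega>
        using NT[of 1 \<omega>] schatten_norm_nonneg[of q "N \<omega>"] by simp
    qed
  qed measurable
  have bound: "(\<integral>\<omega>. schatten_norm q (N \<omega>) \<partial>P) \<le> t \<epsilon> powr (1/r)" if \<epsilon>: "\<epsilon> > 0" for \<epsilon>
  proof -
    have "(\<integral>\<omega>. R \<epsilon> \<omega> \<partial>P) = r/2 * (\<Sum>j\<in>UNIV. h \<epsilon> j powr (r/2 - 1) * (\<integral>\<omega>. (norm (w j v* N \<omega>))\<^sup>2 \<partial>P)) + (1 - r/2) * t \<epsilon>"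
      unfolding R_def using int by (simp add: prob_space)
    also have "\<dots> \<le> r/2 * (\<Sum>j\<in>UNIV. h \<epsilon> j powr (r/2 - 1) * h \<epsilon> j) + (1 - r/2) * t \<epsilon>"
      using le r \<epsilon> by (intro add_right_mono mult_left_mono sum_mono) (auto simp: h_def intro: add_increasing2)
    also have "(\<lambda>j. h \<epsilon> j powr (r/2 - 1) * h \<epsilon> j) = (\<lambda>j. h \<epsilon> j powr (r/2))"
      using h[OF \<epsilon>] by (simp add: mult.commute powr_mult_base less_imp_le)
    finally have R: "(\<integral>\<omega>. R \<epsilon> \<omega> \<partial>P) \<le> t \<epsilon>"
      by (simp add: t_def algebra_simps)
    have "(\<integral>\<omega>. schatten_norm q (N \<omega>) \<partial>P) \<le> (\<integral>\<omega>. T \<epsilon> \<omega> \<partial>P)"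
      using NT[OF \<epsilon>] by (intro integral_mono int_norm intT)
    also have "\<dots> = 1/r * (t \<epsilon> powr (1/r - 1) * (\<integral>\<omega>. R \<epsilon> \<omega> \<partial>P)) + (1 - 1/r) * t \<epsilon> powr (1/r)"
      unfolding T_def using intR by (simp add: prob_space)
    also have "\<dots> \<le> 1/r * (t \<epsilon> powr (1/r - 1) * t \<epsilon>) + (1 - 1/r) * t \<epsilon> powr (1/r)"
      using R r by (intro add_right_mono mult_left_mono) auto
    also have "t \<epsilon> powr (1/r - 1) * t \<epsilon> = t \<epsilon> powr (1/r)"
      using t[OF \<epsilon>] by (simp add: mult.commute powr_mult_base less_imp_le)
    finally show ?thesis
      by (simp add: algebra_simps)
  qed
  \<comment> \<open>The exponents \<open>r/2\<close> and \<open>1/r\<close> are positive, so the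
    powers are continuous from the right even where the base tends to 0.\<close>
  have "((\<lambda>\<epsilon>. t \<epsilon> powr (1/r)) \<longlongrightarrow> t 0 powr (1/r)) (at_right 0)"
  proof (rule tendsto_powr')
    show "(t \<longlongrightarrow> t 0) (at_right 0)"
      unfolding t_def
    proof (rule tendsto_sum, rule tendsto_powr')
      show "((\<lambda>\<epsilon>. h \<epsilon> j) \<longlongrightarrow> h 0 j) (at_right 0)" for j
        unfolding h_def by (intro tendsto_intros) 
      show "h 0 j \<noteq> 0 \<or> 0 < r/2 \<and> (\<forall>\<^sub>F \<epsilon> in at_right 0. 0 \<le> h \<epsilon> j)" for j
        using r h by (auto intro!: eventually_at_rightI[of 0 1] less_imp_le)
    qed auto
    show "t 0 \<noteq> 0 \<or> 0 < 1/r \<and> (\<forall>\<^sub>F \<epsilon> in at_right 0. 0 \<le> t \<epsilon>)"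
      using r t by (auto intro!: eventually_at_rightI[of 0 1] less_imp_le)
  qed auto
  moreover have "\<forall>\<^sub>F \<epsilon> in at_right 0. (\<integral>\<omega>. schatten_norm q (N \<omega>) \<partial>P) \<le> t \<epsilon> powr (1/r)"
    using bound by (auto intro!: eventually_at_rightI[of 0 1])
  ultimately have "(\<integral>\<omega>. schatten_norm q (N \<omega>) \<partial>P) \<le> t 0 powr (1/r)"
    by (rule tendsto_lowerbound) simp
  also have "t 0 powr (1/r) = schatten_norm q V"
    using r by (simp add: t_def h_def power2_powr_half schatten_norm_left_singular_basis[OF w])
  finally show "(\<integral>\<omega>. schatten_norm q (N \<omega>) \<partial>P) \<le> schatten_norm q V" .
qed

section \<open>Stochastic noise accumulated by the momentum\<close>

lemma momentum_add: "momentum \<theta> (\<lambda>j. g j + g' j) k = momentum \<theta> g k + momentum \<theta> g' k"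
  by (induction k) (simp_all add: algebra_simps)

text \<open>The iterates enter the noise analysis only through \<open>adapted\<close>:
  \<open>X k\<close> is determined by the batches strictly before \<open>k\<close>.\<close>

locale adapted_stochastic_oracle = prob_space P for P :: "'w measure" +
  fixes \<Xi> :: "'x measure" and Q :: "'z measure" and \<xi> :: "'z \<Rightarrow> 'x"
    and G :: "real^'n^'m \<Rightarrow> 'x \<Rightarrow> real^'n^'m" and gradf :: "real^'n^'m \<Rightarrow> real^'n^'m"
    and V :: "real^'m^'m" and B :: nat
    and xs :: "nat \<Rightarrow> nat \<Rightarrow> 'w \<Rightarrow> 'x" and X :: "nat \<Rightarrow> 'w \<Rightarrow> real^'n^'m"
  assumes Q: "prob_space Q" and \<xi>: "\<xi> \<in> measurable Q \<Xi>"
    and G [measurable]: "(\<lambda>(Y, x). G Y x) \<in> borel_measurable (borel \<Otimes>\<^sub>M \<Xi>)"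
    and gradf [measurable]: "gradf \<in> borel_measurable borel"
    and unbiased: "\<And>Y. integrable Q (\<lambda>z. G Y (\<xi> z))" "\<And>Y. (\<integral>z. G Y (\<xi> z) \<partial>Q) = gradf Y"
    and variance:
      "\<And>Y. integrable Q (\<lambda>z. (G Y (\<xi> z) - gradf Y) ** transpose (G Y (\<xi> z) - gradf Y))"
      "\<And>Y. (\<integral>z. (G Y (\<xi> z) - gradf Y) ** transpose (G Y (\<xi> z) - gradf Y) \<partial>Q) \<preceq> V ** transpose V"
    and B: "B \<ge> 1"
    and samples: "iid_batches P \<Xi> Q \<xi> B xs"
    and adapted: "\<And>k. X k \<in> borel_measurable (generated_by P \<Xi> (\<lambda>(k, i). xs k i) ({..<k} \<times> {1..B}))"
begin

definition error :: "nat \<times> nat \<Rightarrow> 'w \<Rightarrow> real^'n^'m" where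
  "error e \<omega> = G (X (fst e) \<omega>) (xs (fst e) (snd e) \<omega>) - gradf (X (fst e) \<omega>)"

text \<open>By linearity this is the momentum of the batch means minus the momentum of the exact
  gradients.\<close>

definition noise :: "real \<Rightarrow> nat \<Rightarrow> 'w \<Rightarrow> real^'n^'m" where
  "noise \<theta> k \<omega> = momentum \<theta> (\<lambda>j. batch_mean G B (X j \<omega>) (\<lambda>i. xs j i \<omega>) - gradf (X j \<omega>)) k"

lemma measurable_vector_matrix_mult [measurable]: "(\<lambda>A :: real^'n^'m. w v* A) \<in> borel_measurable borel"
  by (intro borel_measurable_continuous_onI linear_continuous_on bounded_linear_vector_matrix_mult)

lemma sample_measurable: "i \<in> {1..B} \<Longrightarrow> xs k i \<in> measurable P \<Xi>"
  using samples by (auto simp: iid_batches_def indep_vars_def2)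

lemma sample_distr: "i \<in> {1..B} \<Longrightarrow> distr P \<Xi> (xs k i) = distr Q \<Xi> \<xi>"
  using samples by (auto simp: iid_batches_def)

lemma X_measurable [measurable]: "X k \<in> borel_measurable P"
  by (rule measurable_from_generated_by[OF _ adapted]) (auto intro: sample_measurable)

lemma error_measurable_generated:
  assumes "{..<k} \<times> {1..B} \<subseteq> J" "(k, i) \<in> J" "i \<in> {1..B}"
  shows "error (k, i) \<in> borel_measurable (generated_by P \<Xi> (\<lambda>(k, i). xs k i) J)"
proof -
  have [measurable]: "X k \<in> borel_measurable (generated_by P \<Xi> (\<lambda>(k, i). xs k i) J)"
    using assms(1) adapted by (rule measurable_generated_by_mono)
  have [measurable]: "xs k i \<in> measurable (generated_by P \<Xi> (\<lambda>(k, i). xs k i) J) \<Xi>"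
    using measurable_generated_by_component[of "(k, i)" J "\<lambda>(k, i). xs k i"] assms sample_measurable by simp
  show ?thesis
    unfolding error_def by simp
qed

lemma error_measurable:
  assumes "e \<in> UNIV \<times> {1..B}"
  shows "error e \<in> borel_measurable P"
proof -
  obtain k i where e: "e = (k, i)" "i \<in> {1..B}"
    using assms by auto
  have "error (k, i) \<in> borel_measurable (generated_by P \<Xi> (\<lambda>(k, i). xs k i) (UNIV \<times> {1..B}))"
    using e by (intro error_measurable_generated) auto
  then show ?thesis
    unfolding e by (rule measurable_from_generated_by[rotated]) (auto intro: sample_measurable)
qed

lemma sample_joint_distr:
  assumes U: "U \<in> measurable (generated_by P \<Xi> (\<lambda>(k, i). xs k i) J) N"
    and J: "J \<subseteq> UNIV \<times> {1..B}" and i: "i \<in> {1..B}" "(k, i) \<notin> J"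
  shows "U \<in> measurable P N"
    and "distr P (N \<Otimes>\<^sub>M \<Xi>) (\<lambda>\<omega>. (U \<omega>, xs k i \<omega>)) = distr P N U \<Otimes>\<^sub>M distr Q \<Xi> \<xi>"
proof -
  show "U \<in> measurable P N"
    by (rule measurable_from_generated_by[OF _ U]) (use J in \<open>auto intro!: sample_measurable\<close>)
  have "indep_vars (\<lambda>_. \<Xi>) (\<lambda>(k, i). xs k i) (UNIV \<times> {1..B})"
    using samples by (simp add: iid_batches_def)
  from joint_distr_generated_by[OF this J _ i(2) U] i(1)
  show "distr P (N \<Otimes>\<^sub>M \<Xi>) (\<lambda>\<omega>. (U \<omega>, xs k i \<omega>)) = distr P N U \<Otimes>\<^sub>M distr Q \<Xi> \<xi>"
    by (simp add: sample_distr)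
qed

lemma oracle_mean:
  "integrable Q (\<lambda>z. w v* (G Y (\<xi> z) - gradf Y))" "(\<integral>z. w v* (G Y (\<xi> z) - gradf Y) \<partial>Q) = 0"
proof -
  interpret Q: prob_space Q by (rule Q)
  have int: "integrable Q (\<lambda>z. G Y (\<xi> z) - gradf Y)"
    using unbiased by simp
  then show "integrable Q (\<lambda>z. w v* (G Y (\<xi> z) - gradf Y))"
    by (rule integrable_bounded_linear[OF bounded_linear_vector_matrix_mult])
  show "(\<integral>z. w v* (G Y (\<xi> z) - gradf Y) \<partial>Q) = 0"
    unfolding integral_bounded_linear[OF bounded_linear_vector_matrix_mult int]
    using unbiased[of Y] by (simp add: Q.prob_space)
qed

text \<open>The Loewner bound is tested on \<open>w\<close>: the quadratic form of
  \<open>A ** transpose A\<close> at \<open>w\<close> is the squared norm of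
  \<open>w v* A\<close>.\<close>

lemma oracle_second_moment:
  "(\<integral>\<^sup>+z. ennreal ((norm (w v* (G Y (\<xi> z) - gradf Y)))\<^sup>2) \<partial>Q) \<le> ennreal ((norm (w v* V))\<^sup>2)"
proof -
  have quad: "w \<bullet> ((A ** transpose A) *v w) = (norm (w v* A))\<^sup>2" for A :: "real^'k^'m"
    by (simp add: matrix_vector_mul_assoc[symmetric] dot_lmul_matrix[symmetric] power2_norm_eq_inner)
  have lin: "bounded_linear (\<lambda>A :: real^'m^'m. w \<bullet> (A *v w))"
    by (intro linear_conv_bounded_linear[THEN iffD1] linearI)
      (auto simp: matrix_vector_mult_add_rdistrib inner_add_right scaleR_matrix_vector_assoc[symmetric])
  have int: "integrable Q (\<lambda>z. (norm (w v* (G Y (\<xi> z) - gradf Y)))\<^sup>2)"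
    using integrable_bounded_linear[OF lin variance(1)[of Y]] by (simp add: quad)
  have "(\<integral>z. (norm (w v* (G Y (\<xi> z) - gradf Y)))\<^sup>2 \<partial>Q)
      = w \<bullet> ((\<integral>z. (G Y (\<xi> z) - gradf Y) ** transpose (G Y (\<xi> z) - gradf Y) \<partial>Q) *v w)"
    using integral_bounded_linear[OF lin variance(1)[of Y]] by (simp add: quad)
  also have "\<dots> \<le> w \<bullet> ((V ** transpose V) *v w)"
    using variance(2)[of Y] unfolding loewner_le_def psd_def
    by (simp add: matrix_vector_mult_diff_rdistrib inner_diff_right)
  finally show ?thesis
    using int by (simp add: nn_integral_eq_integral quad)
qed

lemma error_second_moment:
  assumes "e \<in> UNIV \<times> {1..B}"
  shows "(\<integral>\<^sup>+\<omega>. ennreal ((norm (w v* error e \<omega>))\<^sup>2) \<partial>P) \<le> ennreal ((norm (w v* V))\<^sup>2)"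
proof -
  obtain k i where e: "e = (k, i)" "i \<in> {1..B}"
    using assms by auto
  have "distr P (borel \<Otimes>\<^sub>M \<Xi>) (\<lambda>\<omega>. (X k \<omega>, xs k i \<omega>)) = distr P borel (X k) \<Otimes>\<^sub>M distr Q \<Xi> \<xi>"
    by (rule sample_joint_distr[OF adapted]) (use e in auto)
  from nn_integral_joint_le[OF X_measurable sample_measurable[OF e(2)] this Q \<xi>,
      of "\<lambda>x. ennreal ((norm (w v* (G (fst x) (snd x) - gradf (fst x))))\<^sup>2)" "ennreal ((norm (w v* V))\<^sup>2)"]
  show ?thesis
    using oracle_second_moment by (simp add: e error_def)
qed

text \<open>By symmetry \<open>e'\<close> may be taken from a batch not earlier than that of
  \<open>e\<close>. Its sample is then fresh relative to \<open>X k'\<close> and to the error at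
  \<open>e\<close>, and the oracle error has mean zero.\<close>

lemma error_orthogonal:
  assumes "e \<in> UNIV \<times> {1..B}" "e' \<in> UNIV \<times> {1..B}" "e \<noteq> e'"
    and int: "integrable P (\<lambda>\<omega>. (w v* error e \<omega>) \<bullet> (w v* error e' \<omega>))"
  shows "(\<integral>\<omega>. (w v* error e \<omega>) \<bullet> (w v* error e' \<omega>) \<partial>P) = 0"
proof -
  have *: "(\<integral>\<omega>. (w v* error e \<omega>) \<bullet> (w v* error e' \<omega>) \<partial>P) = 0"
    if e: "e \<in> UNIV \<times> {1..B}" "e' \<in> UNIV \<times> {1..B}" "e \<noteq> e'" "fst e \<le> fst e'"
      and int: "integrable P (\<lambda>\<omega>. (w v* error e \<omega>) \<bullet> (w v* error e' \<omega>))" for e e'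
  proof -
    obtain k i where ki: "e = (k, i)" "i \<in> {1..B}"
      using e(1) by auto
    obtain k' i' where ki': "e' = (k', i')" "i' \<in> {1..B}"
      using e(2) by auto
    note e_eq = ki(1) ki'(1) ki(2) ki'(2)
    \<comment> \<open>All samples up to batch \<open>k'\<close> except the fresh one; this also
      covers two different samples of the same batch.\<close>
    define J where "J = {..k'} \<times> {1..B} - {(k', i')}"
    let ?F = "generated_by P \<Xi> (\<lambda>(k, i). xs k i) J"
    have "error (k, i) \<in> borel_measurable ?F"
      using e e_eq by (intro error_measurable_generated) (auto simp: J_def)
    then have [measurable]: "(\<lambda>\<omega>. w v* error (k, i) \<omega>) \<in> borel_measurable ?F"
      by measurable
    have [measurable]: "X k' \<in> borel_measurable ?F"
      by (rule measurable_generated_by_mono[OF _ adapted]) (auto simp: J_def)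
    have "(\<lambda>\<omega>. (X k' \<omega>, w v* error (k, i) \<omega>)) \<in> measurable ?F (borel \<Otimes>\<^sub>M borel)"
      by measurable
    note joint = sample_joint_distr[OF this _ e_eq(4), of k']
    have J: "J \<subseteq> UNIV \<times> {1..B}" "(k', i') \<notin> J"
      by (auto simp: J_def)
    from integral_inner_joint_eq_0[OF joint(1)[OF J] sample_measurable[OF e_eq(4)] joint(2)[OF J] Q \<xi>,
        of "\<lambda>x. w v* (G (fst (fst x)) (snd x) - gradf (fst (fst x)))" snd]
    show ?thesis
      using int oracle_mean by (simp add: e_eq error_def)
  qed
  show ?thesis
  proof (cases "fst e \<le> fst e'")
    case False
    then show ?thesis
      using *[of e' e] assms by (simp add: inner_commute)
  qed (use * assms in blast)
qed

text \<open>The sum of squared coefficients obeys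
  \<open>c' = (1 - \<theta>)\<^sup>2 * c + \<theta>\<^sup>2 / B\<close>. The power of
  \<open>1 - \<theta>\<close> in the bound is the remaining weight of the first batch, which enters
  with full weight since \<open>momentum \<theta> g 0 = g 0\<close>.\<close>

lemma noise_linear_combination:
  assumes \<theta>: "0 \<le> \<theta>" "\<theta> \<le> 1"
  shows "\<exists>a. (\<forall>\<omega>. noise \<theta> k \<omega> = (\<Sum>j\<le>k. \<Sum>i=1..B. a (j, i) *\<^sub>R error (j, i) \<omega>)) \<and>
    (\<Sum>j\<le>k. \<Sum>i=1..B. (a (j, i))\<^sup>2) \<le> ((1 - \<theta>) ^ (2 * k) + \<theta>) / B"
proof (induction k)
  have batch: "batch_mean G B (X j \<omega>) (\<lambda>i. xs j i \<omega>) - gradf (X j \<omega>) = (\<Sum>i=1..B. (1 / B) *\<^sub>R error (j, i) \<omega>)" for j \<omega>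
    using B by (simp add: batch_mean_def error_def scaleR_right_diff_distrib sum_subtractf scaleR_sum_right
        sum_constant_scaleR del: sum_constant)
  {
    case 0
    have "(\<Sum>i=1..B. (1 / real B)\<^sup>2) \<le> (1 + \<theta>) / B"
      using B \<theta> by (simp add: power2_eq_square divide_right_mono)
    then show ?case
      by (intro exI[of _ "\<lambda>_. 1 / B"]) (simp add: noise_def batch)
  next
    case (Suc k)
    then obtain a where a: "\<And>\<omega>. noise \<theta> k \<omega> = (\<Sum>j\<le>k. \<Sum>i=1..B. a (j, i) *\<^sub>R error (j, i) \<omega>)"
      "(\<Sum>j\<le>k. \<Sum>i=1..B. (a (j, i))\<^sup>2) \<le> ((1 - \<theta>) ^ (2 * k) + \<theta>) / B"
      by auto
    define a' where "a' e = (if fst e = Suc k then \<theta> / B else (1 - \<theta>) * a e)" for e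
    have "noise \<theta> (Suc k) \<omega> = (\<Sum>j\<le>Suc k. \<Sum>i=1..B. a' (j, i) *\<^sub>R error (j, i) \<omega>)" for \<omega>
    proof -
      have "noise \<theta> (Suc k) \<omega> = (1 - \<theta>) *\<^sub>R noise \<theta> k \<omega> + \<theta> *\<^sub>R (\<Sum>i=1..B. (1 / B) *\<^sub>R error (Suc k, i) \<omega>)"
        by (simp add: noise_def batch)
      then show ?thesis
        by (simp add: a a'_def scaleR_sum_right)
    qed
    moreover have "(\<Sum>j\<le>Suc k. \<Sum>i=1..B. (a' (j, i))\<^sup>2) \<le> ((1 - \<theta>) ^ (2 * Suc k) + \<theta>) / B"
    proof -
      have "(\<Sum>j\<le>Suc k. \<Sum>i=1..B. (a' (j, i))\<^sup>2) = (1 - \<theta>)\<^sup>2 * (\<Sum>j\<le>k. \<Sum>i=1..B. (a (j, i))\<^sup>2) + \<theta>\<^sup>2 / B"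
        using B by (simp add: a'_def power_mult_distrib sum_distrib_left) (simp add: power2_eq_square)
      also have "\<dots> \<le> (1 - \<theta>)\<^sup>2 * (((1 - \<theta>) ^ (2 * k) + \<theta>) / B) + \<theta>\<^sup>2 / B"
        using a(2) by (intro add_right_mono mult_left_mono) auto
      also have "\<dots> = ((1 - \<theta>) ^ (2 * Suc k) + ((1 - \<theta>)\<^sup>2 * \<theta> + \<theta>\<^sup>2)) / B"
        by (simp add: add_divide_distrib distrib_left power2_eq_square mult.assoc)
      also have "\<dots> \<le> ((1 - \<theta>) ^ (2 * Suc k) + \<theta>) / B"
      proof -
        \<comment> \<open>This quantity is exactly the gap between \<open>\<theta>\<close> and
          \<open>(1 - \<theta>)\<^sup>2 * \<theta> + \<theta>\<^sup>2\<close>.\<close>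
        have "0 \<le> \<theta> * \<theta> * (1 - \<theta>)"
          using \<theta> by simp
        then have "(1 - \<theta>)\<^sup>2 * \<theta> + \<theta>\<^sup>2 \<le> \<theta>"
          by (simp add: power2_eq_square algebra_simps)
        then show ?thesis
          by (intro divide_right_mono) auto
      qed
      finally show ?thesis .
    qed
    ultimately show ?case
      by blast
  }
qed

text \<open>Orthogonality of the errors bounds every directional second moment of the noise by that
  of \<open>sqrt c *\<^sub>R V\<close>, so Jensen for random matrices applies with this scaled
  matrix; subadditivity of the square root then separates the two terms of \<open>c\<close>.\<close>

lemma expected_noise_le:
  assumes "schatten_dual_pair p q" and \<theta>: "0 \<le> \<theta>" "\<theta> \<le> 1"
  shows "integrable P (\<lambda>\<omega>. schatten_norm q (noise \<theta> k \<omega>))"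
    and "(\<integral>\<omega>. schatten_norm q (noise \<theta> k \<omega>) \<partial>P) \<le> schatten_norm q V / sqrt B * ((1 - \<theta>) ^ k + sqrt \<theta>)"
proof -
  interpret schatten_dual_pair p q by fact
  obtain a where a: "\<And>\<omega>. noise \<theta> k \<omega> = (\<Sum>j\<le>k. \<Sum>i=1..B. a (j, i) *\<^sub>R error (j, i) \<omega>)"
      "(\<Sum>j\<le>k. \<Sum>i=1..B. (a (j, i))\<^sup>2) \<le> ((1 - \<theta>) ^ (2 * k) + \<theta>) / B"
    using noise_linear_combination[OF \<theta>, of k] by auto
  define I where "I = {..k} \<times> {1..B}"
  define c where "c = ((1 - \<theta>) ^ (2 * k) + \<theta>) / B"
  have noise: "noise \<theta> k = (\<lambda>\<omega>. \<Sum>e\<in>I. a e *\<^sub>R error e \<omega>)" and ac: "(\<Sum>e\<in>I. (a e)\<^sup>2) \<le> c"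
    using a by (auto simp: I_def c_def sum.cartesian_product)
  have "c \<ge> 0"
    using \<theta> by (simp add: c_def)
  have I: "e \<in> UNIV \<times> {1..B}" if "e \<in> I" for e
    using that by (auto simp: I_def)
  have meas: "noise \<theta> k \<in> borel_measurable P"
    unfolding noise using I error_measurable by (intro borel_measurable_sum borel_measurable_scaleR) auto
  have lin: "w v* noise \<theta> k \<omega> = (\<Sum>e\<in>I. a e *\<^sub>R (w v* error e \<omega>))" for w \<omega>
    unfolding noise
    by (simp add: linear_sum[OF bounded_linear.linear[OF bounded_linear_vector_matrix_mult]] vector_scaleR_matrix_ac)
  have ms: "(\<lambda>\<omega>. w v* error e \<omega>) \<in> borel_measurable P" if "e \<in> I" for w e
    using error_measurable[OF I[OF that]] by measurable
  have "finite I"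
    by (simp add: I_def)
  note second = second_moment_orthogonal_sum[OF \<open>finite I\<close> ms error_second_moment[OF I] zero_le_power2
      error_orthogonal[OF I I]]
  have int: "integrable P (\<lambda>\<omega>. (norm (w v* noise \<theta> k \<omega>))\<^sup>2)" for w
    unfolding lin by (rule second(1))
  have le: "(\<integral>\<omega>. (norm (w v* noise \<theta> k \<omega>))\<^sup>2 \<partial>P) \<le> (norm (w v* (sqrt c *\<^sub>R V)))\<^sup>2" for w
  proof -
    have "(\<integral>\<omega>. (norm (w v* noise \<theta> k \<omega>))\<^sup>2 \<partial>P) \<le> (\<Sum>e\<in>I. (a e)\<^sup>2) * (norm (w v* V))\<^sup>2"
      unfolding lin by (rule second(2))
    also have "\<dots> \<le> c * (norm (w v* V))\<^sup>2"
      using ac by (rule mult_right_mono) simp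
    finally show ?thesis
      using \<open>c \<ge> 0\<close> by (simp add: vector_scaleR_matrix_ac power_mult_distrib)
  qed
  note E = expected_schatten_norm_le[OF prob_space_axioms meas int le]
  show "integrable P (\<lambda>\<omega>. schatten_norm q (noise \<theta> k \<omega>))"
    by (rule E)
  have "sqrt c = sqrt (((1 - \<theta>) ^ k)\<^sup>2 + \<theta>) / sqrt B"
    by (simp add: c_def real_sqrt_divide power_mult[symmetric] mult.commute)
  also have "\<dots> \<le> ((1 - \<theta>) ^ k + sqrt \<theta>) / sqrt B"
    using \<theta> sqrt_add_le_add_sqrt[of "((1 - \<theta>) ^ k)\<^sup>2" \<theta>] by (intro divide_right_mono) auto
  finally have "sqrt c * schatten_norm q V \<le> ((1 - \<theta>) ^ k + sqrt \<theta>) / sqrt B * schatten_norm q V"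
    by (rule mult_right_mono) (rule schatten_norm_nonneg)
  with E(2) show "(\<integral>\<omega>. schatten_norm q (noise \<theta> k \<omega>) \<partial>P) \<le> schatten_norm q V / sqrt B * ((1 - \<theta>) ^ k + sqrt \<theta>)"
    using \<open>c \<ge> 0\<close> by (simp add: schatten_norm_scaleR[OF q(1)] mult.commute)
qed

end

section \<open>The ball oracle method\<close>

text \<open>The gap \<open>\<phi>\<close> between the two sides along the segment has nonpositive
  derivative, by Hoelder and the Lipschitz bound.\<close>

lemma (in schatten_dual_pair) smooth_upper_bound:
  fixes f :: "real^'n^'m \<Rightarrow> real"
  assumes grad: "\<And>Y. GDERIV f Y :> gradf Y"
    and smooth: "\<And>Y Z. schatten_norm q (gradf Z - gradf Y) \<le> L * schatten_norm p (Z - Y)"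
  shows "f (Y + d) \<le> f Y + gradf Y \<bullet> d + L / 2 * (schatten_norm p d)\<^sup>2"
proof -
  define \<phi> where "\<phi> t = f (Y + t *\<^sub>R d) - t * (gradf Y \<bullet> d) - L / 2 * t\<^sup>2 * (schatten_norm p d)\<^sup>2" for t
  have "\<phi> 1 \<le> \<phi> 0"
  proof (rule DERIV_nonpos_imp_nonincreasing[of 0 1 \<phi>])
    fix t :: real assume t: "0 \<le> t"
    let ?D = "d \<bullet> gradf (Y + t *\<^sub>R d) - gradf Y \<bullet> d - L * t * (schatten_norm p d)\<^sup>2"
    have "((\<lambda>t. f (Y + t *\<^sub>R d)) has_derivative (\<lambda>s. (s *\<^sub>R d) \<bullet> gradf (Y + t *\<^sub>R d))) (at t)"
      by (rule has_derivative_compose[where f = "\<lambda>t. Y + t *\<^sub>R d", OF _ grad[unfolded gderiv_def]])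
        (auto intro!: derivative_eq_intros)
    moreover have "(\<lambda>s. (s *\<^sub>R d) \<bullet> gradf (Y + t *\<^sub>R d)) = (*) (d \<bullet> gradf (Y + t *\<^sub>R d))"
      by (simp add: fun_eq_iff mult.commute)
    ultimately have "((\<lambda>t. f (Y + t *\<^sub>R d)) has_real_derivative d \<bullet> gradf (Y + t *\<^sub>R d)) (at t)"
      by (simp add: has_field_derivative_def)
    then have "(\<phi> has_real_derivative ?D) (at t)"
      unfolding \<phi>_def by (auto intro!: derivative_eq_intros)
    moreover have "?D \<le> 0"
    proof -
      have "(gradf (Y + t *\<^sub>R d) - gradf Y) \<bullet> d
          \<le> schatten_norm q (gradf (Y + t *\<^sub>R d) - gradf Y) * schatten_norm p d"
        by (rule schatten_norm_holder)
      also have "\<dots> \<le> L * schatten_norm p (t *\<^sub>R d) * schatten_norm p d"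
        using smooth[of "Y + t *\<^sub>R d" Y] by (intro mult_right_mono) (simp_all add: schatten_norm_nonneg)
      also have "\<dots> = L * t * (schatten_norm p d)\<^sup>2"
        using t by (simp add: schatten_norm_scaleR[OF p_ge_1] power2_eq_square)
      finally show ?thesis
        by (simp add: inner_diff_left inner_diff_right inner_commute)
    qed
    ultimately show "\<exists>y. (\<phi> has_real_derivative y) (at t) \<and> y \<le> 0"
      by blast
  qed simp
  then show ?thesis
    by (simp add: \<phi>_def)
qed

text \<open>The minimizer is compared with the feasible point \<open>X - \<eta> *\<^sub>R C\<close>,
  where \<open>C\<close> is dual to \<open>M\<close>. The error \<open>M - gradf X\<close> is paid
  twice, once in the linear term of the smoothness bound and once in passing from the norm of
  \<open>M\<close> to that of the gradient; hence the factor 2.\<close>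

lemma (in schatten_dual_pair) ball_oracle_step:
  fixes f :: "real^'n^'m \<Rightarrow> real" and M :: "real^'n^'m"
  assumes grad: "\<And>Y. GDERIV f Y :> gradf Y"
    and smooth: "\<And>Y Z. schatten_norm q (gradf Z - gradf Y) \<le> L * schatten_norm p (Z - Y)"
    and "0 \<le> L" "0 \<le> \<eta>"
    and min: "is_arg_min (\<lambda>Y. M \<bullet> (Y - X)) (\<lambda>Y. schatten_norm p (Y - X) \<le> \<eta>) X'"
  shows "schatten_norm p (X' - X) \<le> \<eta>"
    and "\<eta> * schatten_norm q (gradf X)
      \<le> f X - f X' + 2 * \<eta> * schatten_norm q (M - gradf X) + L / 2 * \<eta>\<^sup>2"
proof -
  define d where "d = X' - X"
  show d: "schatten_norm p (X' - X) \<le> \<eta>"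
    using min by (simp add: is_arg_min_def)
  obtain C where C: "schatten_norm p C \<le> 1" "M \<bullet> C = schatten_norm q M"
    using schatten_norm_dual by metis
  have "schatten_norm p ((- \<eta>) *\<^sub>R C) \<le> \<eta>"
    unfolding schatten_norm_scaleR[OF p_ge_1] using C(1) \<open>0 \<le> \<eta>\<close> by (simp add: mult_left_le)
  then have "\<not> M \<bullet> ((X + (- \<eta>) *\<^sub>R C) - X) < M \<bullet> (X' - X)"
    using min unfolding is_arg_min_def by (metis add_diff_cancel_left')
  then have Md: "M \<bullet> d \<le> - \<eta> * schatten_norm q M"
    using C(2) by (simp add: d_def)
  have neg: "schatten_norm q (- A) = schatten_norm q A" for A :: "real^'n^'m"
    using schatten_norm_scaleR[OF q(1), of "-1" A] by simp
  have "- (M - gradf X) \<bullet> d \<le> schatten_norm q (- (M - gradf X)) * schatten_norm p d"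
    by (rule schatten_norm_holder)
  also have "\<dots> \<le> \<eta> * schatten_norm q (M - gradf X)"
    unfolding neg using d by (subst mult.commute) (intro mult_right_mono, simp_all add: d_def schatten_norm_nonneg)
  finally have Ed: "- (M - gradf X) \<bullet> d \<le> \<eta> * schatten_norm q (M - gradf X)" .
  have "schatten_norm q (gradf X) \<le> schatten_norm q M + schatten_norm q (M - gradf X)"
    using schatten_norm_triangle[of M "- (M - gradf X)"] unfolding neg by simp
  from mult_left_mono[OF this \<open>0 \<le> \<eta>\<close>]
  have g: "\<eta> * schatten_norm q (gradf X) \<le> \<eta> * schatten_norm q M + \<eta> * schatten_norm q (M - gradf X)"
    by (simp add: distrib_left)
  have "(schatten_norm p d)\<^sup>2 \<le> \<eta>\<^sup>2"
    using d by (intro power_mono) (simp_all add: d_def schatten_norm_nonneg)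
  then have "L / 2 * (schatten_norm p d)\<^sup>2 \<le> L / 2 * \<eta>\<^sup>2"
    using \<open>0 \<le> L\<close> by (intro mult_left_mono) auto
  moreover have "f X' \<le> f X + gradf X \<bullet> d + L / 2 * (schatten_norm p d)\<^sup>2"
    using smooth_upper_bound[of f gradf L X d, OF grad smooth] by (simp add: d_def)
  moreover have "gradf X \<bullet> d = M \<bullet> d + - (M - gradf X) \<bullet> d"
    by (simp add: inner_diff_left)
  ultimately show "\<eta> * schatten_norm q (gradf X)
      \<le> f X - f X' + 2 * \<eta> * schatten_norm q (M - gradf X) + L / 2 * \<eta>\<^sup>2"
    using Md Ed g by linarith
qed

text \<open>The bound is the fixed point of the map sending \<open>x\<close> to
  \<open>(1 - \<theta>) * (x + c)\<close>, which governs one step of the recursion, and the drift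
  starts at zero.\<close>

lemma (in schatten_dual_pair) momentum_drift_le:
  fixes g :: "nat \<Rightarrow> real^'n^'m"
  assumes \<theta>: "0 < \<theta>" "\<theta> \<le> 1" and step: "\<And>k. schatten_norm q (g k - g (Suc k)) \<le> c"
  shows "schatten_norm q (momentum \<theta> g k - g k) \<le> c * (1 - \<theta>) / \<theta>"
proof (induction k)
  case 0
  have "0 \<le> c"
    using step[of 0] schatten_norm_nonneg order_trans by blast
  then show ?case
    using \<theta> schatten_norm_scaleR[OF q(1), of 0 "0 :: real^'n^'m"] by simp
next
  case (Suc k)
  have "momentum \<theta> g (Suc k) - g (Suc k) = (1 - \<theta>) *\<^sub>R ((momentum \<theta> g k - g k) + (g k - g (Suc k)))"
    by (simp add: algebra_simps)
  then have "schatten_norm q (momentum \<theta> g (Suc k) - g (Suc k))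
      = (1 - \<theta>) * schatten_norm q ((momentum \<theta> g k - g k) + (g k - g (Suc k)))"
    using \<theta> by (simp only: schatten_norm_scaleR[OF q(1)])
  also have "\<dots> \<le> (1 - \<theta>) * (c * (1 - \<theta>) / \<theta> + c)"
    using \<theta> Suc step[of k] schatten_norm_triangle[of "momentum \<theta> g k - g k" "g k - g (Suc k)"]
    by (intro mult_left_mono) linarith+
  also have "\<dots> = c * (1 - \<theta>) / \<theta>"
    using \<theta> by (simp add: field_simps)
  finally show ?case .
qed

text \<open>With \<open>a = sqrt (\<Delta> * L / K)\<close> and \<open>y = sqrt \<theta>\<close>
  every term becomes elementary: \<open>L * \<eta> = a * y\<close>,
  \<open>\<Delta> / (\<eta> * K) = a / y\<close>, and the drift is \<open>a / y - a * y\<close>. The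
  two branches of \<open>\<theta>\<close> are then checked separately.\<close>

lemma step_size_tradeoff:
  fixes \<Delta> L \<sigma> \<theta> \<eta> K :: real
  assumes pos: "\<Delta> > 0" "L > 0" "K \<ge> 1" "\<sigma> \<ge> 0"
    and \<theta>: "\<theta> = (if \<sigma> = 0 then 1 else min (1 / \<sigma> * sqrt (\<Delta> * L / K)) 1)"
    and \<eta>: "\<eta> = sqrt (\<Delta> * \<theta> / (L * K))"
  shows "\<Delta> / (\<eta> * K) + 2 * (\<sigma> / (\<theta> * K) + \<sigma> * sqrt \<theta> + L * \<eta> * (1 - \<theta>) / \<theta>) + L / 2 * \<eta>
    \<le> 6 * sqrt \<sigma> * (\<Delta> * L / K) powr (1 / 4) + 8 * sqrt (\<Delta> * L / K) + 2 * \<sigma>\<^sup>2 / sqrt (\<Delta> * L * K)"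
proof -
  define a where "a = sqrt (\<Delta> * L / K)"
  define y where "y = sqrt \<theta>"
  have a: "a > 0"
    using pos by (simp add: a_def)
  have "\<theta> > 0" "\<theta> \<le> 1"
    using a pos by (auto simp: \<theta> a_def)
  then have y: "y > 0" "y \<le> 1" "\<theta> = y * y"
    by (simp_all add: y_def)
  have L\<eta>: "L * \<eta> = a * y"
  proof -
    have "L * \<eta> = sqrt (L\<^sup>2 * (\<Delta> * \<theta> / (L * K)))"
      unfolding real_sqrt_mult \<eta> using pos by simp
    also have "L\<^sup>2 * (\<Delta> * \<theta> / (L * K)) = (\<Delta> * L / K) * \<theta>"
      using pos by (simp add: power2_eq_square field_simps)
    finally show ?thesis
      by (simp only: a_def y_def real_sqrt_mult)
  qed
  have aa: "a * a = \<Delta> * L / K"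
    using pos by (simp add: a_def)
  have "\<eta> = a * y / L"
    using L\<eta> pos by (simp add: field_simps)
  then have "\<Delta> / (\<eta> * K) = (\<Delta> * L / K) / (a * y)"
    using pos by simp
  then have \<Delta>\<eta>: "\<Delta> / (\<eta> * K) = a / y"
    using a y by (simp add: aa[symmetric])
  have drift: "L * \<eta> * (1 - \<theta>) / \<theta> = a / y - a * y"
    using y by (simp add: L\<eta> field_simps)
  have aK: "a * K = sqrt (\<Delta> * L * K)"
  proof -
    have "a * K = sqrt (\<Delta> * L / K * K\<^sup>2)"
      unfolding real_sqrt_mult a_def using pos by simp
    also have "\<Delta> * L / K * K\<^sup>2 = \<Delta> * L * K"
      using pos by (simp add: power2_eq_square)
    finally show ?thesis .
  qed
  have a4: "(\<Delta> * L / K) powr (1 / 4) = sqrt a"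
    using pos by (simp add: a_def powr_half_sqrt[symmetric] powr_powr)
  have "L / 2 * \<eta> = a * y / 2"
    using L\<eta> by simp
  then have "\<Delta> / (\<eta> * K) + 2 * (\<sigma> / (\<theta> * K) + \<sigma> * sqrt \<theta> + L * \<eta> * (1 - \<theta>) / \<theta>) + L / 2 * \<eta>
      = 3 * (a / y) + 2 * (\<sigma> * y) + 2 * (\<sigma> / (\<theta> * K)) - 3 / 2 * (a * y)"
    unfolding \<Delta>\<eta> drift y_def[symmetric] by simp
  also have "\<dots> \<le> 3 * (a / y) + 2 * (\<sigma> * y) + 2 * (\<sigma> / (\<theta> * K))"
    using a y by simp
  also have "\<dots> \<le> 6 * (sqrt \<sigma> * sqrt a) + 8 * a + 2 * (\<sigma>\<^sup>2 / (a * K))"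
  \<comment> \<open>For small noise \<open>\<theta> = 1\<close>, and
    \<open>3 * a + 2 * \<sigma> + 2 * \<sigma> / K\<close> is at most \<open>7 * a\<close>.
    Otherwise \<open>\<theta> = a / \<sigma>\<close> balances \<open>a / y\<close> and
    \<open>\<sigma> * y\<close>, both equal to \<open>sqrt \<sigma> * sqrt a\<close>.\<close>
  proof (cases "\<sigma> \<le> a")
    case True
    then have "\<theta> = 1"
      using pos by (auto simp: \<theta> a_def[symmetric])
    moreover from this have "y = 1"
      by (simp add: y_def)
    moreover have "\<sigma> / K \<le> \<sigma>"
      using pos mult_left_mono[of 1 K \<sigma>] by (simp add: divide_le_eq)
    moreover have "0 \<le> sqrt \<sigma> * sqrt a" "0 \<le> \<sigma>\<^sup>2 / (a * K)"
      using pos a by auto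
    ultimately show ?thesis
      using True a by simp
  next
    case False
    then have \<sigma>: "\<sigma> > 0"
      using a by simp
    then have "a / \<sigma> \<le> 1"
      using False by simp
    then have th: "\<theta> = a / \<sigma>"
      unfolding \<theta> a_def[symmetric] using \<sigma> by simp
    have y': "y = sqrt a / sqrt \<sigma>"
      by (simp add: y_def th real_sqrt_divide)
    have "a / y = sqrt \<sigma> * sqrt a" "\<sigma> * y = sqrt \<sigma> * sqrt a"
      unfolding y' using a \<sigma> by (simp_all add: field_simps)
    moreover have "\<sigma> / (\<theta> * K) = \<sigma>\<^sup>2 / (a * K)"
      using \<sigma> by (simp add: th power2_eq_square)
    moreover have "0 \<le> sqrt \<sigma> * sqrt a"
      using a \<sigma> by simp
    ultimately show ?thesis
      using a by simp
  qed
  finally show ?thesis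
    unfolding a4 a_def[symmetric] aK[symmetric] by simp
qed

section \<open>Assembly of the convergence rate from adaptedness, summed descent and the noise
  bound\<close>

theorem theorem1:
  fixes f :: "real^'n^'m \<Rightarrow> real"
    and gradf :: "real^'n^'m \<Rightarrow> real^'n^'m"
    and f_low L \<Delta> \<sigma> \<eta> \<theta> :: real
    and p q :: ereal
    and V :: "real^'m^'m"
    and \<Xi> :: "'x measure"
    and Q :: "'z measure"
    and \<xi> :: "'z \<Rightarrow> 'x"
    and G :: "real^'n^'m \<Rightarrow> 'x \<Rightarrow> real^'n^'m"
    and P :: "'w measure"
    and xs :: "nat \<Rightarrow> nat \<Rightarrow> 'w \<Rightarrow> 'x"
    and X0 :: "real^'n^'m"
    and X :: "nat \<Rightarrow> 'w \<Rightarrow> real^'n^'m"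
    and B K :: nat
  assumes dims: "CARD('m) \<le> CARD('n)"
    and grad: "\<And>Y. GDERIV f Y :> gradf Y"
    and grad_cont: "continuous_on UNIV gradf"
    and lower: "\<And>Y. f_low \<le> f Y"
    and p: "2 \<le> p"
    and q: "1 \<le> q" "q \<le> 2"
    and conj: "1 / p + 1 / q = 1"
    and L: "L > 0"
    and smooth: "\<And>Y Z. schatten_norm q (gradf Z - gradf Y) \<le> L * schatten_norm p (Z - Y)"
    and Q: "prob_space Q"
    and \<xi>: "\<xi> \<in> measurable Q \<Xi>"
    and G: "(\<lambda>(Y, x). G Y x) \<in> borel_measurable (borel \<Otimes>\<^sub>M \<Xi>)"
    and unbiased: "\<And>Y. integrable Q (\<lambda>z. G Y (\<xi> z))"
      "\<And>Y. (\<integral>z. G Y (\<xi> z) \<partial>Q) = gradf Y"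
    and variance:
      "\<And>Y. integrable Q (\<lambda>z. (G Y (\<xi> z) - gradf Y) ** transpose (G Y (\<xi> z) - gradf Y))"
      "\<And>Y. (\<integral>z. (G Y (\<xi> z) - gradf Y) ** transpose (G Y (\<xi> z) - gradf Y) \<partial>Q)
              \<preceq> V ** transpose V"
    and B: "B \<ge> 1"
    and K: "K \<ge> 1"
    and \<Delta>: "\<Delta> = f X0 - f_low" "\<Delta> > 0"
    and \<sigma>: "\<sigma> = schatten_norm q V / sqrt (real B)"
    and \<theta>: "\<theta> = (if \<sigma> = 0 then 1 else min (1 / \<sigma> * sqrt (\<Delta> * L / real K)) 1)"
    and \<eta>: "\<eta> = sqrt (\<Delta> * \<theta> / (L * real K))"
    and P: "prob_space P"
    and samples: "iid_batches P \<Xi> Q \<xi> B xs"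
    and iterates: "ball_oracle_iterates P \<Xi> xs G X0 \<theta> p \<eta> B X"
  shows "(\<forall>k<K. integrable P (\<lambda>\<omega>. schatten_norm q (gradf (X k \<omega>)))) \<and>
    1 / real K * (\<Sum>k=0..K-1. \<integral>\<omega>. schatten_norm q (gradf (X k \<omega>)) \<partial>P)
      \<le> 6 * sqrt \<sigma> * (\<Delta> * L / real K) powr (1 / 4)
        + 8 * sqrt (\<Delta> * L / real K)
        + 2 * \<sigma>\<^sup>2 / sqrt (\<Delta> * L * real K)"
proof -
  interpret schatten_dual_pair p q
    using p q conj by unfold_locales
  interpret prob_space P by (rule P)
  have X0: "\<And>\<omega>. \<omega> \<in> space P \<Longrightarrow> X 0 \<omega> = X0"
    and X_min: "\<And>k \<omega>. \<omega> \<in> space P \<Longrightarrow>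
      is_arg_min (\<lambda>Y. momentum \<theta> (\<lambda>j. batch_mean G B (X j \<omega>) (\<lambda>i. xs j i \<omega>)) k \<bullet> (Y - X k \<omega>))
        (\<lambda>Y. schatten_norm p (Y - X k \<omega>) \<le> \<eta>) (X (Suc k) \<omega>)"
    and X_Suc: "\<And>k. X (Suc k) \<in> borel_measurable (sigma (space P)
      {xs s i -` A \<inter> space P | s i A. s \<le> k \<and> i \<in> {1..B} \<and> A \<in> sets \<Xi>})"
    using iterates by (auto simp: ball_oracle_iterates_def Let_def)
  have adapted: "X k \<in> borel_measurable (generated_by P \<Xi> (\<lambda>(k, i). xs k i) ({..<k} \<times> {1..B}))" for k
  proof (cases k)
    case 0
    have "X 0 \<in> borel_measurable N \<longleftrightarrow> (\<lambda>_. X0) \<in> borel_measurable N" if "space N = space P" for N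
      using X0 that by (intro measurable_cong) auto
    then show ?thesis
      using 0 by simp
  next
    case (Suc l)
    have "{xs s i -` A \<inter> space P | s i A. s \<le> l \<and> i \<in> {1..B} \<and> A \<in> sets \<Xi>}
        = {(case e of (k, i) \<Rightarrow> xs k i) -` A \<inter> space P | e A. e \<in> {..<k} \<times> {1..B} \<and> A \<in> sets \<Xi>}"
      using Suc by (auto simp: less_Suc_eq_le)
    then show ?thesis
      using X_Suc[of l] Suc by (simp add: generated_by_def)
  qed
  interpret adapted_stochastic_oracle P \<Xi> Q \<xi> G gradf V B xs X
    by (intro adapted_stochastic_oracle.intro adapted_stochastic_oracle_axioms.intro)
      (fact P Q \<xi> G unbiased variance B samples adapted borel_measurable_continuous_onI[OF grad_cont])+
  have \<sigma>0: "0 \<le> \<sigma>"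
    using B by (simp add: \<sigma> schatten_norm_nonneg)
  have \<theta>01: "0 < \<theta>" "\<theta> \<le> 1"
    using \<sigma>0 \<Delta> L K by (auto simp: \<theta>)
  have \<eta>0: "0 < \<eta>"
    using \<theta>01 \<Delta> L K by (simp add: \<eta>)
  define D where "D = L * \<eta> * (1 - \<theta>) / \<theta>"
  define ng where "ng = (\<lambda>k \<omega>. schatten_norm q (gradf (X k \<omega>)))"
  have close: "schatten_norm p (X (Suc k) \<omega> - X k \<omega>) \<le> \<eta>" if "\<omega> \<in> space P" for k \<omega>
    by (rule ball_oracle_step(1)[of f gradf L, OF grad smooth _ _ X_min[OF that]]) (use L \<eta>0 in auto)
  have grad_step: "schatten_norm q (gradf Y - gradf Z) \<le> L * \<eta>" if "schatten_norm p (Y - Z) \<le> \<eta>" for Y Z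
    using order_trans[OF smooth mult_left_mono[OF that]] L by simp
  have close': "schatten_norm p (X k \<omega> - X (Suc k) \<omega>) \<le> \<eta>" if "\<omega> \<in> space P" for k \<omega>
    using close[OF that] schatten_norm_scaleR[OF p_ge_1, of "-1" "X (Suc k) \<omega> - X k \<omega>"] by simp
  have descent: "\<eta> * ng k \<omega> \<le> f (X k \<omega>) - f (X (Suc k) \<omega>)
      + 2 * \<eta> * (schatten_norm q (noise \<theta> k \<omega>) + D) + L / 2 * \<eta>\<^sup>2" if \<omega>: "\<omega> \<in> space P" for k \<omega>
  proof -
    define g where "g j = gradf (X j \<omega>)" for j
    let ?b = "\<lambda>j. batch_mean G B (X j \<omega>) (\<lambda>i. xs j i \<omega>)"
    have "momentum \<theta> ?b k = noise \<theta> k \<omega> + momentum \<theta> g k"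
      unfolding noise_def momentum_add[symmetric] by (simp add: g_def)
    then have "momentum \<theta> ?b k - gradf (X k \<omega>) = noise \<theta> k \<omega> + (momentum \<theta> g k - g k)"
      by (simp add: g_def)
    moreover have "schatten_norm q (momentum \<theta> g k - g k) \<le> D"
      unfolding D_def using \<theta>01 grad_step[OF close'[OF \<omega>]] by (intro momentum_drift_le) (simp_all add: g_def)
    ultimately have "schatten_norm q (momentum \<theta> ?b k - gradf (X k \<omega>)) \<le> schatten_norm q (noise \<theta> k \<omega>) + D"
      using schatten_norm_triangle[of "noise \<theta> k \<omega>" "momentum \<theta> g k - g k"] by simp
    then have "2 * \<eta> * schatten_norm q (momentum \<theta> ?b k - gradf (X k \<omega>)) \<le> 2 * \<eta> * (schatten_norm q (noise \<theta> k \<omega>) + D)"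
      using \<eta>0 by (intro mult_left_mono) auto
    moreover have "\<eta> * ng k \<omega> \<le> f (X k \<omega>) - f (X (Suc k) \<omega>)
        + 2 * \<eta> * schatten_norm q (momentum \<theta> ?b k - gradf (X k \<omega>)) + L / 2 * \<eta>\<^sup>2"
      unfolding ng_def
      by (rule ball_oracle_step(2)[of f gradf L, OF grad smooth _ _ X_min[OF \<omega>]]) (use L \<eta>0 in auto)
    ultimately show ?thesis
      by linarith
  qed
  have ng_bound: "ng k \<omega> \<le> schatten_norm q (gradf X0) + k * (L * \<eta>)" if \<omega>: "\<omega> \<in> space P" for k \<omega>
  proof (induction k)
    case 0
    then show ?case
      by (simp add: ng_def X0[OF \<omega>])
  next
    case (Suc k)
    then show ?case
      using schatten_norm_triangle[of "gradf (X k \<omega>)" "gradf (X (Suc k) \<omega>) - gradf (X k \<omega>)"]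
        grad_step[OF close[OF \<omega>, of k]] by (simp add: ng_def algebra_simps)
  qed
  have int: "integrable P (ng k)" for k
  proof (rule integrable_const_bound[where B = "schatten_norm q (gradf X0) + k * (L * \<eta>)"])
    show "ng k \<in> borel_measurable P"
      unfolding ng_def by measurable
    show "AE \<omega> in P. norm (ng k \<omega>) \<le> schatten_norm q (gradf X0) + k * (L * \<eta>)"
      using ng_bound by (intro AE_I2) (simp add: ng_def schatten_norm_nonneg)
  qed
  have sum_descent: "(\<Sum>k<K. \<eta> * ng k \<omega>) \<le> \<Delta> + (\<Sum>k<K. 2 * \<eta> * (schatten_norm q (noise \<theta> k \<omega>) + D) + L / 2 * \<eta>\<^sup>2)"
    if \<omega>: "\<omega> \<in> space P" for \<omega>
  proof -
    have "(\<Sum>k<K. \<eta> * ng k \<omega>) \<le> (\<Sum>k<K. (f (X k \<omega>) - f (X (Suc k) \<omega>))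
        + (2 * \<eta> * (schatten_norm q (noise \<theta> k \<omega>) + D) + L / 2 * \<eta>\<^sup>2))"
      using descent[OF \<omega>] by (intro sum_mono) (simp add: add.assoc)
    also have "\<dots> = (f (X 0 \<omega>) - f (X K \<omega>)) + (\<Sum>k<K. 2 * \<eta> * (schatten_norm q (noise \<theta> k \<omega>) + D) + L / 2 * \<eta>\<^sup>2)"
      by (simp only: sum.distrib sum_lessThan_telescope'[of "\<lambda>k. f (X k \<omega>)"])
    finally show ?thesis
      using lower[of "X K \<omega>"] X0[OF \<omega>] \<Delta>(1) by simp
  qed
  note noise_le = expected_noise_le[OF schatten_dual_pair_axioms less_imp_le[OF \<theta>01(1)] \<theta>01(2)]
  have noise_sum: "(\<Sum>k<K. \<integral>\<omega>. schatten_norm q (noise \<theta> k \<omega>) \<partial>P) \<le> \<sigma> / \<theta> + K * (\<sigma> * sqrt \<theta>)"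
  proof -
    have "(\<Sum>k<K. \<integral>\<omega>. schatten_norm q (noise \<theta> k \<omega>) \<partial>P) \<le> (\<Sum>k<K. \<sigma> * ((1 - \<theta>) ^ k + sqrt \<theta>))"
      using noise_le(2) by (intro sum_mono) (simp add: \<sigma>)
    also have "\<dots> = \<sigma> * (\<Sum>k<K. (1 - \<theta>) ^ k) + K * (\<sigma> * sqrt \<theta>)"
      by (simp add: distrib_left sum.distrib sum_distrib_left)
    also have "(\<Sum>k<K. (1 - \<theta>) ^ k) = (1 - (1 - \<theta>) ^ K) / \<theta>"
      using \<theta>01 by (subst sum_gp_strict) auto
    also have "\<sigma> * ((1 - (1 - \<theta>) ^ K) / \<theta>) \<le> \<sigma> * (1 / \<theta>)"
      using \<theta>01 \<sigma>0 by (intro mult_left_mono divide_right_mono) auto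
    finally show ?thesis
      by simp
  qed
  have "\<eta> * (\<Sum>k<K. \<integral>\<omega>. ng k \<omega> \<partial>P) = (\<integral>\<omega>. (\<Sum>k<K. \<eta> * ng k \<omega>) \<partial>P)"
    using int by (simp add: sum_distrib_left)
  also have "\<dots> \<le> (\<integral>\<omega>. \<Delta> + (\<Sum>k<K. 2 * \<eta> * (schatten_norm q (noise \<theta> k \<omega>) + D) + L / 2 * \<eta>\<^sup>2) \<partial>P)"
    using int noise_le(1) sum_descent by (intro integral_mono) auto
  also have "\<dots> = \<Delta> + (2 * \<eta> * ((\<Sum>k<K. \<integral>\<omega>. schatten_norm q (noise \<theta> k \<omega>) \<partial>P) + K * D) + K * (L / 2 * \<eta>\<^sup>2))"
    using noise_le(1) by (simp add: prob_space sum.distrib distrib_left sum_distrib_left)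
  also have "\<dots> \<le> \<Delta> + (2 * \<eta> * ((\<sigma> / \<theta> + K * (\<sigma> * sqrt \<theta>)) + K * D) + K * (L / 2 * \<eta>\<^sup>2))"
    using noise_sum \<eta>0 by (intro add_left_mono add_right_mono mult_left_mono) auto
  finally have total: "\<eta> * (\<Sum>k<K. \<integral>\<omega>. ng k \<omega> \<partial>P)
      \<le> \<Delta> + (2 * \<eta> * ((\<sigma> / \<theta> + K * (\<sigma> * sqrt \<theta>)) + K * D) + K * (L / 2 * \<eta>\<^sup>2))" .
  have "1 / K * (\<Sum>k<K. \<integral>\<omega>. ng k \<omega> \<partial>P) = (\<eta> * (\<Sum>k<K. \<integral>\<omega>. ng k \<omega> \<partial>P)) / (\<eta> * K)"
    using \<eta>0 by simp
  also have "\<dots> \<le> (\<Delta> + (2 * \<eta> * ((\<sigma> / \<theta> + K * (\<sigma> * sqrt \<theta>)) + K * D) + K * (L / 2 * \<eta>\<^sup>2))) / (\<eta> * K)"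
    using total \<eta>0 by (intro divide_right_mono) auto
  also have "\<dots> = \<Delta> / (\<eta> * K) + 2 * (\<sigma> / (\<theta> * K) + \<sigma> * sqrt \<theta> + L * \<eta> * (1 - \<theta>) / \<theta>) + L / 2 * \<eta>"
    unfolding D_def[symmetric] using \<eta>0 K \<theta>01 by (simp add: field_simps power2_eq_square)
  also have "\<dots> \<le> 6 * sqrt \<sigma> * (\<Delta> * L / K) powr (1 / 4) + 8 * sqrt (\<Delta> * L / K) + 2 * \<sigma>\<^sup>2 / sqrt (\<Delta> * L * K)"
    using \<Delta>(2) L K \<sigma>0 \<theta> \<eta> by (intro step_size_tradeoff) auto
  finally have main: "1 / K * (\<Sum>k<K. \<integral>\<omega>. ng k \<omega> \<partial>P)
      \<le> 6 * sqrt \<sigma> * (\<Delta> * L / K) powr (1 / 4) + 8 * sqrt (\<Delta> * L / K) + 2 * \<sigma>\<^sup>2 / sqrt (\<Delta> * L * K)" .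
  have "{0..K - 1} = {..<K}"
    using K by auto
  then show ?thesis
    using main int by (simp add: ng_def)
qed

end
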